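(* Let $\mathscr{H}$ be a complex Hilbert space, let $A\in\mathbb{B}(\mathscr{H})$ be a $G_1$ operator with $\sigma(A)\subset\mathbb{D}$, and let $f\in\mathfrak{A}$. Then for every $X\in\mathbb{B}(\mathscr{H})$, $$w\big(f(A)X+X\bar f(A)\big)\le \frac{2}{d_A^2}\,w\big(X-AXA^*\big)$$ and $$w\big(f(A)X-X\bar f(A)\big)\le \frac{4}{d_A^2}\,\|A\|\,w(X).$$
   Context: $\mathbb{B}(\mathscr{H})$ is the algebra of all bounded linear operators on the complex Hilbert space $(\mathscr{H},\langle\cdot,\cdot\rangle)$, with identity $I$; $\|\cdot\|$ is the operator norm, and a scalar $z$ stands for $zI$. The numerical radius of $A\in\mathbb{B}(\mathscr{H})$ is $w(A)=\sup\{|\langle Ax,x\rangle| : x\in\mathscr{H},\ \|x\|=1\}$. The operator $A$ is called a $G_1$ operator if $\|(z-A)^{-1}\|=\frac{1}{\mathrm{dist}(z,\sigma(A))}$ for all $z\in\mathbb{C}$ not in the spectrum $\sigma(A)$. $\mathbb{D}=\{z\in\mathbb{C}:|z|<1\}$, $\partial\mathbb{D}$ is its boundary, and $d_A=\mathrm{dist}(\partial\mathbb{D},\sigma(A))$. $\mathfrak{A}$ is the set of analytic functions $f:\mathbb{D}\to\mathbb{C}$ with $\mathrm{Re}(f)>0$ on $\mathbb{D}$ and $f(0)=1$. For $f$ analytic on an open neighborhood $\Omega$ of $\sigma(A)$, $f(A)=\frac{1}{2\pi i}\int_C f(z)(z-A)^{-1}\,dz$ (Riesz-Dunford integral), where $C$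 is a positively oriented simple closed rectifiable contour surrounding $\sigma(A)$ in $\Omega$. $\bar f$ is the conjugate function of $f$, and $\bar f(A)=(f(A))^*$. *)

theory Defs
  imports "HOL-Complex_Analysis.Complex_Analysis"
begin

text \<open>Complex Hilbert spaces, with the inner product linear in the first argument. The real
  vector space structure inherited from \<^class>\<open>banach\<close> is the restriction of the complex one, and
  positive definiteness of the inner product is contained in \<open>cinner_self\<close>.\<close>

class complex_hilbert = banach +
  fixes scaleC :: "complex \<Rightarrow> 'a \<Rightarrow> 'a" (infixr \<open>*\<^sub>C\<close> 75)
    and cinner :: "'a \<Rightarrow> 'a \<Rightarrow> complex"
  assumes scaleC_add_right: "c *\<^sub>C (x + y) = c *\<^sub>C x + c *\<^sub>C y"
    and scaleC_add_left: "(c + d) *\<^sub>C x = c *\<^sub>C x + d *\<^sub>C x"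
    and scaleC_scaleC: "c *\<^sub>C d *\<^sub>C x = (c * d) *\<^sub>C x"
    and scaleR_scaleC: "r *\<^sub>R x = complex_of_real r *\<^sub>C x"
    and cinner_add_left: "cinner (x + y) z = cinner x z + cinner y z"
    and cinner_scaleC_left: "cinner (c *\<^sub>C x) y = c * cinner x y"
    and cinner_commute: "cinner x y = cnj (cinner y x)"
    and cinner_self: "cinner x x = complex_of_real ((norm x)\<^sup>2)"

lemma norm_scaleC: "norm (c *\<^sub>C x) = cmod c * norm x"
  for x :: "'a::complex_hilbert"
proof -
  have "complex_of_real ((norm (c *\<^sub>C x))\<^sup>2) = c * cnj (c * cnj (cinner x x))"
    by (subst cinner_self[symmetric], subst cinner_scaleC_left, subst cinner_commute,
        subst cinner_scaleC_left, subst cinner_self) (simp add: cinner_self)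
  also have "\<dots> = (c * cnj c) * complex_of_real ((norm x)\<^sup>2)"
    by (simp add: cinner_self)
  also have "\<dots> = complex_of_real ((cmod c * norm x)\<^sup>2)"
    by (simp only: complex_norm_square[symmetric] power_mult_distrib of_real_mult)
  finally have "(norm (c *\<^sub>C x))\<^sup>2 = (cmod c * norm x)\<^sup>2"
    using of_real_eq_iff by blast
  then show ?thesis
    by (rule power2_eq_imp_eq) auto
qed

instantiation complex :: complex_hilbert
begin
definition scaleC_complex :: "complex \<Rightarrow> complex \<Rightarrow> complex" where "scaleC_complex c z = c * z"
definition cinner_complex :: "complex \<Rightarrow> complex \<Rightarrow> complex" where "cinner_complex z w = z * cnj w"
instance
  by standard (auto simp: scaleC_complex_def cinner_complex_def algebra_simps scaleR_conv_of_real
      simp flip: complex_norm_square)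
end

text \<open>The type \<^typ>\<open>'a \<Rightarrow>\<^sub>L 'a\<close> consists of the bounded real-linear operators, normed by the
  operator norm; the algebra of bounded operators on the Hilbert space is its complex-linear part.\<close>

definition bounded_ops :: "('a::complex_hilbert \<Rightarrow>\<^sub>L 'a) set" where
  "bounded_ops = {T. \<forall>c x. blinfun_apply T (c *\<^sub>C x) = c *\<^sub>C blinfun_apply T x}"

text \<open>\<open>scalar_op z\<close> is the operator \<open>zI\<close>; the multiple \<open>zT\<close> of an operator \<open>T\<close> is
  \<open>scalar_op z o\<^sub>L T\<close>.\<close>

lift_definition scalar_op :: "complex \<Rightarrow> 'a::complex_hilbert \<Rightarrow>\<^sub>L 'a" is "\<lambda>z x. z *\<^sub>C x"
proof
  fix z :: complex and x y :: 'a and r :: real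
  show "z *\<^sub>C (x + y) = z *\<^sub>C x + z *\<^sub>C y"
    by (rule scaleC_add_right)
  show "z *\<^sub>C (r *\<^sub>R x) = r *\<^sub>R (z *\<^sub>C x)"
    by (simp add: scaleR_scaleC scaleC_scaleC mult.commute)
  show "\<exists>K. \<forall>x::'a. norm (z *\<^sub>C x) \<le> norm x * K"
    by (intro exI[of _ "cmod z"]) (simp add: norm_scaleC)
qed

definition adj :: "('a::complex_hilbert \<Rightarrow>\<^sub>L 'a) \<Rightarrow> 'a \<Rightarrow>\<^sub>L 'a" where
  "adj T = (THE S. \<forall>x y. cinner (blinfun_apply T x) y = cinner x (blinfun_apply S y))"

definition is_inverse_op :: "('a::complex_hilbert \<Rightarrow>\<^sub>L 'a) \<Rightarrow> ('a \<Rightarrow>\<^sub>L 'a) \<Rightarrow> bool" where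
  "is_inverse_op T S \<longleftrightarrow> S \<in> bounded_ops \<and> T o\<^sub>L S = id_blinfun \<and> S o\<^sub>L T = id_blinfun"

definition spectrum :: "('a::complex_hilbert \<Rightarrow>\<^sub>L 'a) \<Rightarrow> complex set" where
  "spectrum A = {z. \<not> (\<exists>S. is_inverse_op (scalar_op z - A) S)}"

definition resolvent :: "('a::complex_hilbert \<Rightarrow>\<^sub>L 'a) \<Rightarrow> complex \<Rightarrow> 'a \<Rightarrow>\<^sub>L 'a" where
  "resolvent A z = (THE S. is_inverse_op (scalar_op z - A) S)"

definition G1_operator :: "('a::complex_hilbert \<Rightarrow>\<^sub>L 'a) \<Rightarrow> bool" where
  "G1_operator A \<longleftrightarrow> A \<in> bounded_ops \<and>
     (\<forall>z. z \<notin> spectrum A \<longrightarrow> norm (resolvent A z) = 1 / infdist z (spectrum A))"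

text \<open>The supremum is taken in \<open>[0, \<infinity>)\<close>: the element \<open>0\<close> only matters on the zero space, which
  has no unit vectors.\<close>

definition numerical_radius :: "('a::complex_hilbert \<Rightarrow>\<^sub>L 'a) \<Rightarrow> real" where
  "numerical_radius A = Sup (insert 0 {cmod (cinner (blinfun_apply A x) x) | x. norm x = 1})"

definition surrounding_contour :: "complex set \<Rightarrow> complex set \<Rightarrow> (real \<Rightarrow> complex) \<Rightarrow> bool" where
  "surrounding_contour \<Omega> K \<gamma> \<longleftrightarrow>
     valid_path \<gamma> \<and> simple_path \<gamma> \<and> pathfinish \<gamma> = pathstart \<gamma> \<and>
     (\<forall>z\<in>inside (path_image \<gamma>). winding_number \<gamma> z = 1) \<and>
     K \<subseteq> inside (path_image \<gamma>) \<and> path_image \<gamma> \<union> inside (path_image \<gamma>) \<subseteq> \<Omega>"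

definition op_contour_integral ::
    "(real \<Rightarrow> complex) \<Rightarrow> (complex \<Rightarrow> 'a::complex_hilbert \<Rightarrow>\<^sub>L 'a) \<Rightarrow> 'a \<Rightarrow>\<^sub>L 'a" where
  "op_contour_integral \<gamma> F =
     integral {0..1} (\<lambda>t. scalar_op (vector_derivative \<gamma> (at t within {0..1})) o\<^sub>L F (\<gamma> t))"

text \<open>The Riesz--Dunford operator \<open>f(A)\<close> for \<open>f\<close> analytic on the open set \<open>\<Omega>\<close>. Its value does not
  depend on the contour, by Cauchy's theorem.\<close>

definition riesz_dunford ::
    "complex set \<Rightarrow> (complex \<Rightarrow> complex) \<Rightarrow> ('a::complex_hilbert \<Rightarrow>\<^sub>L 'a) \<Rightarrow> 'a \<Rightarrow>\<^sub>L 'a" where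
  "riesz_dunford \<Omega> f A =
     (let \<gamma> = (SOME \<gamma>. surrounding_contour \<Omega> (spectrum A) \<gamma>)
      in scalar_op (1 / (2 * of_real pi * \<i>)) o\<^sub>L
         op_contour_integral \<gamma> (\<lambda>z. scalar_op (f z) o\<^sub>L resolvent A z))"

definition frakA :: "(complex \<Rightarrow> complex) set" where
  "frakA = {f. f analytic_on ball 0 1 \<and> (\<forall>z\<in>ball 0 1. Re (f z) > 0) \<and> f 0 = 1}"

definition dist_circle_spectrum :: "('a::complex_hilbert \<Rightarrow>\<^sub>L 'a) \<Rightarrow> real" where
  "dist_circle_spectrum A = setdist (sphere 0 1) (spectrum A)"

end

theory Submission
  imports Defs
begin

text \<open>
  For a scalar \<open>z\<close> off the spectrum let \<open>P(z) = (z + A) (z - A)\<^sup>-\<^sup>1\<close>. By Schwarz's integral formula, \<open>f(A)\<close>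
  is the mean of \<open>P(z)\<close> over the circle \<open>\<bar>z\<bar> = r\<close> with respect to the weight \<open>Re f(z)\<close>, which is positive and of
  total mass \<open>Re f(0) = 1\<close> (\<open>schwarz_formula\<close>). Therefore \<open>f(A) X \<plusminus> X f(A)\<^sup>*\<close> is the same weighted
  mean of \<open>P(z) X \<plusminus> X P(z)\<^sup>*\<close>, and these operators factor (\<open>Cayley_sandwich\<close>) as
  \<open>2 R (r\<^sup>2 X - A X A\<^sup>*) R\<^sup>*\<close> and \<open>2 R (cnj z A X - z X A\<^sup>*) R\<^sup>*\<close> with \<open>R = (z - A)\<^sup>-\<^sup>1\<close>. Now
  \<open>w (R Y R\<^sup>*) \<le> \<parallel>R\<parallel>\<^sup>2 w Y\<close>, the \<open>G\<^sub>1\<close> condition says that \<open>\<parallel>R\<parallel>\<close> is the reciprocal of the distance of \<open>z\<close> to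
  the spectrum, and \<open>w (T X - X T\<^sup>*) \<le> 2 \<parallel>T\<parallel> w X\<close> (\<open>twisted_commutator_le\<close>). Letting \<open>r\<close> tend to \<open>1\<close>
  gives both inequalities. Working on circles inside the disc avoids Herglotz's representation of \<open>f\<close>
  by a measure on the unit circle.

  Operators are handled through their matrix elements \<open>\<langle>T x, y\<rangle>\<close>. What this needs is the existence of adjoints
  (\<open>Riesz_representation\<close>), the convergence of the operator-valued contour integral for the contour in the definition of \<open>f(A)\<close>
  (\<open>integrable_op_contour\<close>), and the independence of its matrix elements of the contour
  (\<open>contour_integral_eq_circlepath\<close>).
\<close>

section \<open>The inner product\<close>

lemma scaleC_minus_one: "(-1) *\<^sub>C x = - x" for x :: "'a::complex_hilbert"
  using scaleR_scaleC[of "-1" x] by simp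

lemma scaleC_zero_right [simp]: "c *\<^sub>C 0 = (0::'a::complex_hilbert)"
  using norm_scaleC[of c "0::'a"] by simp

lemma cinner_minus_left: "cinner (- x) y = - cinner x y" for x y :: "'a::complex_hilbert"
  using cinner_scaleC_left[of "-1" x y] by (simp add: scaleC_minus_one)

lemma cinner_diff_left: "cinner (x - y) z = cinner x z - cinner y z"
  for x y z :: "'a::complex_hilbert"
  using cinner_add_left[of x "- y" z] by (simp add: cinner_minus_left)

lemma cinner_add_right: "cinner x (y + z) = cinner x y + cinner x z"
  for x y z :: "'a::complex_hilbert"
  by (metis cinner_add_left cinner_commute complex_cnj_add)

lemma cinner_diff_right: "cinner x (y - z) = cinner x y - cinner x z"
  for x y z :: "'a::complex_hilbert"
  by (metis cinner_diff_left cinner_commute complex_cnj_diff)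

lemma cinner_scaleC_right: "cinner x (c *\<^sub>C y) = cnj c * cinner x y"
  for x y :: "'a::complex_hilbert"
  by (metis cinner_scaleC_left cinner_commute complex_cnj_mult)

lemma cinner_scaleR_left: "cinner (r *\<^sub>R x) y = of_real r * cinner x y"
  for x y :: "'a::complex_hilbert"
  by (simp add: scaleR_scaleC cinner_scaleC_left)

lemma cinner_scaleR_right: "cinner x (r *\<^sub>R y) = of_real r * cinner x y"
  for x y :: "'a::complex_hilbert"
  by (simp add: scaleR_scaleC cinner_scaleC_right)

lemma cinner_zero_left [simp]: "cinner 0 y = 0" for y :: "'a::complex_hilbert"
  using cinner_diff_left[of y y y] by simp

lemma cinner_zero_right [simp]: "cinner y 0 = 0" for y :: "'a::complex_hilbert"
  using cinner_diff_right[of y y y] by simp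

lemmas cinner_simps = cinner_add_left cinner_add_right cinner_diff_left cinner_diff_right
  cinner_scaleC_left cinner_scaleC_right cinner_scaleR_left cinner_scaleR_right

lemma cinner_eqI:
  fixes x y :: "'a::complex_hilbert"
  assumes "\<And>z. cinner x z = cinner y z"
  shows "x = y"
proof -
  have "cinner (x - y) (x - y) = 0"
    using assms[of "x - y"] by (simp add: cinner_diff_left)
  then show ?thesis
    by (simp add: cinner_self)
qed

lemma Re_cinner_commute: "Re (cinner x y) = Re (cinner y x)"
  for x y :: "'a::complex_hilbert"
  by (subst cinner_commute) simp

lemma norm_add_squared: "(norm (x + y))\<^sup>2 = (norm x)\<^sup>2 + (norm y)\<^sup>2 + 2 * Re (cinner x y)"
  for x y :: "'a::complex_hilbert"
proof -
  have "complex_of_real ((norm (x + y))\<^sup>2)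
      = of_real ((norm x)\<^sup>2) + of_real ((norm y)\<^sup>2) + (cinner x y + cnj (cinner x y))"
    by (simp add: cinner_self[symmetric] cinner_simps del: of_real_power)
       (simp add: cinner_commute[of y x])
  then have "Re (complex_of_real ((norm (x + y))\<^sup>2))
      = Re (of_real ((norm x)\<^sup>2) + of_real ((norm y)\<^sup>2) + (cinner x y + cnj (cinner x y)))"
    by presburger
  then show ?thesis by (simp del: of_real_power)
qed

lemma norm_diff_squared: "(norm (x - y))\<^sup>2 = (norm x)\<^sup>2 + (norm y)\<^sup>2 - 2 * Re (cinner x y)"
  for x y :: "'a::complex_hilbert"
  using norm_add_squared[of x "- y"] cinner_scaleR_right[of x "-1" y] by simp

lemma Re_cinner_le: "Re (cinner x y) \<le> norm x * norm y"
  for x y :: "'a::complex_hilbert"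
proof (cases "x = 0 \<or> y = 0")
  case False
  have "0 \<le> (norm (norm y *\<^sub>R x - norm x *\<^sub>R y))\<^sup>2" by simp
  also have "\<dots> = 2 * ((norm x * norm y) * (norm x * norm y - Re (cinner x y)))"
    unfolding norm_diff_squared by (simp add: cinner_simps algebra_simps power2_eq_square)
  finally have "0 \<le> (norm x * norm y) * (norm x * norm y - Re (cinner x y))" by simp
  moreover have "0 < norm x * norm y" using False by simp
  ultimately show ?thesis by (simp add: zero_le_mult_iff)
qed auto

lemma exists_phase: "\<exists>c. cmod c = 1 \<and> c * z = of_real (cmod z)"
proof (cases "z = 0")
  case False
  have "cnj z * z = of_real (cmod z) * of_real (cmod z)"
    by (metis complex_norm_square mult.commute power2_eq_square of_real_mult)
  with False show ?thesis
    by (intro exI[of _ "cnj z / of_real (cmod z)"]) (simp add: norm_divide)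
qed (auto intro: exI[of _ 1])

lemma cinner_Cauchy_Schwarz: "cmod (cinner x y) \<le> norm x * norm y"
  for x y :: "'a::complex_hilbert"
proof -
  obtain c where c: "cmod c = 1" "c * cinner x y = of_real (cmod (cinner x y))"
    using exists_phase by blast
  have "cmod (cinner x y) = Re (cinner (c *\<^sub>C x) y)"
    by (simp add: cinner_simps c)
  also have "\<dots> \<le> norm (c *\<^sub>C x) * norm y" by (rule Re_cinner_le)
  finally show ?thesis by (simp add: norm_scaleC c)
qed

lemma bounded_linear_cinner_left: "bounded_linear (\<lambda>x. cinner x y)"
  for y :: "'a::complex_hilbert"
  by (rule bounded_linear_intro[where K = "norm y"])
     (auto simp: cinner_simps cinner_Cauchy_Schwarz scaleR_conv_of_real)

section \<open>Adjoints\<close>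

text \<open>The representing vector is the minimizer of \<open>J x = \<parallel>x\<parallel>\<^sup>2 - 2 Re (\<phi> x)\<close>, which exists by
  completeness and is characterized by the vanishing of all directional derivatives of \<open>J\<close>.\<close>

lemma Riesz_representation:
  fixes \<phi> :: "'a::complex_hilbert \<Rightarrow> complex"
  assumes bl: "bounded_linear \<phi>" and lin: "\<And>c x. \<phi> (c *\<^sub>C x) = c * \<phi> x"
  shows "\<exists>v. \<forall>x. \<phi> x = cinner x v"
proof -
  interpret bounded_linear \<phi> by (rule bl)
  define J where "J = (\<lambda>x. (norm x)\<^sup>2 - 2 * Re (\<phi> x))"
  define m where "m = Inf (range J)"
  obtain K where K: "\<And>x. norm (\<phi> x) \<le> norm x * K" using bounded by blast
  have low: "- K\<^sup>2 \<le> J x" for x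
  proof -
    have "Re (\<phi> x) \<le> norm x * K" using K[of x] complex_Re_le_cmod[of "\<phi> x"] by linarith
    moreover have "0 \<le> (norm x - K)\<^sup>2" by simp
    ultimately show ?thesis by (simp add: J_def power2_diff)
  qed
  have m: "m \<le> J x" for x
    unfolding m_def by (rule cINF_lower[of J UNIV, simplified]) (auto intro!: bdd_belowI2 low)
  have "\<exists>x. J x < m + inverse (Suc n)" for n
  proof -
    have "Inf (range J) < m + inverse (Suc n)" by (simp add: m_def)
    then show ?thesis by (subst (asm) cInf_less_iff) (auto intro!: bdd_belowI2 low)
  qed
  then obtain X where X: "\<And>n. J (X n) < m + inverse (Suc n)" by metis
  \<comment> \<open>The parallelogram law: a sequence minimizing the functional is Cauchy.\<close>
  have par: "(norm (x - y))\<^sup>2 \<le> 2 * (J x - m) + 2 * (J y - m)" for x y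
  proof -
    have "(norm (x - y))\<^sup>2 = 2 * (norm x)\<^sup>2 + 2 * (norm y)\<^sup>2 - (norm (x + y))\<^sup>2"
      by (simp add: norm_add_squared norm_diff_squared)
    moreover have "(norm ((1/2) *\<^sub>R (x + y)))\<^sup>2 = (norm (x + y))\<^sup>2 / 4"
      by (simp add: power_divide)
    moreover have "Re (\<phi> ((1/2) *\<^sub>R (x + y))) = (Re (\<phi> x) + Re (\<phi> y)) / 2"
      by (simp add: scaleR add)
    ultimately have "(norm (x - y))\<^sup>2 = 2 * J x + 2 * J y - 4 * J ((1/2) *\<^sub>R (x + y))"
      unfolding J_def by argo
    then show ?thesis using m[of "(1/2) *\<^sub>R (x + y)"] by simp
  qed
  have "Cauchy X"
  proof (rule metric_CauchyI)
    fix e :: real assume "0 < e"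
    then have "0 < e\<^sup>2 / 4" by simp
    from reals_Archimedean[OF this] obtain N where N: "inverse (real (Suc N)) < e\<^sup>2 / 4" by auto
    have "dist (X p) (X q) < e" if "p \<ge> N" "q \<ge> N" for p q
    proof -
      have "inverse (real (Suc p)) \<le> inverse (real (Suc N))"
           "inverse (real (Suc q)) \<le> inverse (real (Suc N))"
        using that by (auto intro!: le_imp_inverse_le)
      then have "(norm (X p - X q))\<^sup>2 < e\<^sup>2"
        using par[of "X p" "X q"] X[of p] X[of q] N by argo
      then show ?thesis
        using \<open>0 < e\<close> by (simp add: dist_norm power2_less_imp_less)
    qed
    then show "\<exists>M. \<forall>p\<ge>M. \<forall>q\<ge>M. dist (X p) (X q) < e" by blast
  qed
  then obtain v where v: "X \<longlonglongrightarrow> v" by (auto dest: Cauchy_convergent convergentD)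
  have "(\<lambda>n. J (X n)) \<longlonglongrightarrow> J v"
    unfolding J_def by (intro tendsto_intros tendsto v)
  moreover have "(\<lambda>n. m + inverse (real (Suc n))) \<longlonglongrightarrow> m + 0"
    by (intro tendsto_intros LIMSEQ_inverse_real_of_nat)
  ultimately have Jv: "J v \<le> m"
    using X by (intro LIMSEQ_le[of "\<lambda>n. J (X n)"]) (auto intro: less_imp_le)
  have re: "Re (\<phi> h) = Re (cinner h v)" for h
  proof -
    define b where "b = Re (cinner h v) - Re (\<phi> h)"
    define a where "a = (norm h)\<^sup>2"
    \<comment> \<open>Any \<open>t\<close> of the sign of \<open>-b\<close> and small enough makes \<open>t\<^sup>2 a + 2 t b\<close> negative unless \<open>b = 0\<close>; the \<open>+ 1\<close> allows \<open>a = 0\<close>.\<close>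
    define t where "t = - b / (a + 1)"
    have a: "a \<ge> 0" by (simp add: a_def)
    have "J (t *\<^sub>R h + v) = J v + t\<^sup>2 * a + 2 * t * b"
      by (simp add: J_def norm_add_squared cinner_simps scaleR add a_def b_def
          power_mult_distrib algebra_simps Re_cinner_commute[of v h])
    then have "0 \<le> t\<^sup>2 * a + 2 * t * b"
      using m[of "t *\<^sub>R h + v"] Jv by linarith
    also have "\<dots> = - (b\<^sup>2 * (a + 2) / (a + 1)\<^sup>2)"
    proof -
      have "a + 1 \<noteq> 0" using a by linarith
      then show ?thesis by (simp add: t_def divide_simps power2_eq_square) (simp add: algebra_simps)
    qed
    finally have "b\<^sup>2 * (a + 2) / (a + 1)\<^sup>2 \<le> 0" by simp
    then have "b\<^sup>2 * (a + 2) \<le> 0"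
      using a by (simp add: divide_le_0_iff)
    then have "b = 0" using a by (simp add: mult_le_0_iff)
    then show ?thesis by (simp add: b_def)
  qed
  have "\<phi> h = cinner h v" for h
  proof (rule complex_eqI)
    show "Re (\<phi> h) = Re (cinner h v)" by (rule re)
    \<comment> \<open>Multiplication by \<open>-\<i>\<close> turns imaginary parts into real parts.\<close>
    show "Im (\<phi> h) = Im (cinner h v)"
      using re[of "(-\<i>) *\<^sub>C h"] by (simp add: lin cinner_simps)
  qed
  then show ?thesis by blast
qed

lemma bounded_ops_scaleC: "T \<in> bounded_ops \<Longrightarrow> T (c *\<^sub>C x) = c *\<^sub>C T x"
  by (simp add: bounded_ops_def)

lemma adjoint_exists:
  fixes T :: "'a::complex_hilbert \<Rightarrow>\<^sub>L 'a"
  assumes T: "T \<in> bounded_ops"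
  obtains S :: "'a \<Rightarrow>\<^sub>L 'a"
  where "\<And>x y. cinner (T x) y = cinner x (S y)"
proof -
  have "\<exists>v. \<forall>x. cinner (T x) y = cinner x v" for y
    by (rule Riesz_representation)
       (auto simp: bounded_ops_scaleC[OF T] cinner_simps
          intro!: bounded_linear_compose[OF bounded_linear_cinner_left] blinfun.bounded_linear_right)
  then obtain s where s: "\<And>x y. cinner (T x) y = cinner x (s y)" by metis
  have eq: "u = w" if "\<And>x. cinner x u = cinner x w" for u w :: 'a
    by (rule cinner_eqI) (simp only: cinner_commute[of u] cinner_commute[of w] that)
  have "bounded_linear s"
  proof (rule bounded_linear_intro[where K = "norm T"])
    show "s (x + y) = s x + s y" for x y
      by (rule eq) (simp add: s[symmetric] cinner_simps)
    show "s (r *\<^sub>R x) = r *\<^sub>R s x" for r x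
      by (rule eq) (simp add: s[symmetric] cinner_simps)
    fix y
    have "(norm (s y))\<^sup>2 = cmod (cinner (T (s y)) y)"
      by (simp add: s cinner_self del: of_real_power)
    also have "\<dots> \<le> norm (T (s y)) * norm y" by (rule cinner_Cauchy_Schwarz)
    also have "\<dots> \<le> (norm T * norm (s y)) * norm y"
      by (intro mult_right_mono norm_blinfun) auto
    finally have "norm (s y) * norm (s y) \<le> norm (s y) * (norm y * norm T)"
      by (simp add: power2_eq_square algebra_simps)
    then show "norm (s y) \<le> norm y * norm T"
      by (cases "s y = 0") auto
  qed
  then show ?thesis
    using that[of "Blinfun s"] s by (simp add: bounded_linear_Blinfun_apply)
qed

text \<open>By the representation theorem the definite description in \<^const>\<open>adj\<close> does denote an operator
  as soon as \<open>T\<close> is complex-linear.\<close>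

lemma cinner_adj:
  fixes T :: "'a::complex_hilbert \<Rightarrow>\<^sub>L 'a"
  assumes "T \<in> bounded_ops"
  shows "cinner (T x) y = cinner x (adj T y)"
proof -
  obtain S :: "'a \<Rightarrow>\<^sub>L 'a" where S: "\<And>x y. cinner (T x) y = cinner x (S y)"
    using adjoint_exists[OF assms] by blast
  have adj: "adj T = S"
    unfolding adj_def
  proof (rule the_equality)
    fix U :: "'a \<Rightarrow>\<^sub>L 'a" assume U: "\<forall>x y. cinner (T x) y = cinner x (U y)"
    show "U = S"
    proof (rule blinfun_eqI, rule cinner_eqI)
      fix y x
      have "cinner x (U y) = cinner x (S y)" by (metis S U)
      then show "cinner (U y) x = cinner (S y) x"
        unfolding cinner_commute[of "U y" x] cinner_commute[of "S y" x] by simp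
    qed
  qed (simp add: S)
  show ?thesis unfolding adj by (rule S)
qed

lemma cinner_adj':
  "T \<in> bounded_ops \<Longrightarrow> cinner (adj T x) y = cinner x (T y)"
  unfolding cinner_commute[of "adj T x" y] cinner_commute[of x "T y"] by (simp only: cinner_adj)

lemma norm_adj_apply_le:
  assumes "T \<in> bounded_ops"
  shows "norm (adj T y) \<le> norm T * norm y"
proof -
  have "(norm (adj T y))\<^sup>2 = cmod (cinner (T (adj T y)) y)"
    by (simp add: cinner_adj[OF assms] cinner_self del: of_real_power)
  also have "\<dots> \<le> norm (T (adj T y)) * norm y" by (rule cinner_Cauchy_Schwarz)
  also have "\<dots> \<le> (norm T * norm (adj T y)) * norm y"
    by (intro mult_right_mono norm_blinfun) auto
  finally have "norm (adj T y) * norm (adj T y) \<le> norm (adj T y) * (norm T * norm y)"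
    by (simp add: power2_eq_square algebra_simps)
  then show ?thesis by (cases "adj T y = 0") auto
qed

section \<open>The numerical radius\<close>

lemma bdd_above_numerical_range:
  "bdd_above (insert 0 {cmod (cinner (blinfun_apply T x) x) | x. norm x = 1})"
proof (rule bdd_aboveI)
  fix v assume "v \<in> insert 0 {cmod (cinner (blinfun_apply T x) x) | x. norm x = 1}"
  then show "v \<le> norm T"
  proof safe
    fix x :: 'a assume "norm x = 1"
    then show "cmod (cinner (blinfun_apply T x) x) \<le> norm T"
      using cinner_Cauchy_Schwarz[of "T x" x] norm_blinfun[of T x] by simp
  qed simp
qed

lemma numerical_radius_nonneg: "0 \<le> numerical_radius T"
  unfolding numerical_radius_def by (rule cSup_upper[OF _ bdd_above_numerical_range]) blast

lemma cinner_le_numerical_radius: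
  fixes T :: "'a::complex_hilbert \<Rightarrow>\<^sub>L 'a"
  shows "cmod (cinner (T x) x) \<le> numerical_radius T * (norm x)\<^sup>2"
proof (cases "x = 0")
  case False
  define u where "u = (1 / norm x) *\<^sub>R x"
  have "norm u = 1" using False by (simp add: u_def)
  then have "cmod (cinner (T u) u) \<le> numerical_radius T"
    unfolding numerical_radius_def by (intro cSup_upper[OF _ bdd_above_numerical_range]) blast
  moreover have "cmod (cinner (T u) u) = cmod (cinner (T x) x) / (norm x)\<^sup>2"
    by (simp add: u_def blinfun.scaleR_right cinner_simps norm_mult norm_divide power2_eq_square)
  ultimately show ?thesis using False by (simp add: divide_le_eq)
qed simp

lemma numerical_radius_le:
  fixes T :: "'a::complex_hilbert \<Rightarrow>\<^sub>L 'a"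
  assumes "0 \<le> c" "\<And>x. norm x = 1 \<Longrightarrow> cmod (cinner (T x) x) \<le> c"
  shows "numerical_radius T \<le> c"
  unfolding numerical_radius_def by (rule cSup_least) (use assms in auto)

text \<open>The left-hand side is twice the real part of the Hermitian form of the self-adjoint operator
  \<open>Re (c X)\<close>, whose quadratic form is bounded by the numerical radius of \<open>X\<close>. For a self-adjoint
  operator the numerical radius is the norm; this is polarization, applied after
  rescaling \<open>x\<close> to the length of \<open>y\<close>.\<close>

lemma Re_polar_bound:
  fixes X :: "'a::complex_hilbert \<Rightarrow>\<^sub>L 'a"
  assumes c: "cmod c = 1"
  shows "Re (c * cinner (X x) y) + Re (c * cinner (X y) x) \<le> 2 * numerical_radius X * (norm x * norm y)"
proof (cases "x = 0 \<or> y = 0")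
  case False
  let ?w = "numerical_radius X"
  define s where "s = norm y / norm x"
  have s: "s > 0" using False by (simp add: s_def)
  define q where "q = (\<lambda>z. Re (c * cinner (X z) z))"
  have q: "\<bar>q z\<bar> \<le> ?w * (norm z)\<^sup>2" for z
    using abs_Re_le_cmod[of "c * cinner (X z) z"] cinner_le_numerical_radius[of X z]
    by (simp add: q_def norm_mult c)
  have "2 * s * (Re (c * cinner (X x) y) + Re (c * cinner (X y) x)) = q (s *\<^sub>R x + y) - q (s *\<^sub>R x - y)"
    unfolding q_def by (simp add: blinfun.bilinear_simps cinner_simps algebra_simps)
  also have "\<dots> \<le> ?w * (norm (s *\<^sub>R x + y))\<^sup>2 + ?w * (norm (s *\<^sub>R x - y))\<^sup>2"
    using q[of "s *\<^sub>R x + y"] q[of "s *\<^sub>R x - y"] by linarith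
  also have "\<dots> = ?w * (2 * (norm (s *\<^sub>R x))\<^sup>2 + 2 * (norm y)\<^sup>2)"
    unfolding norm_add_squared norm_diff_squared by (simp only: distrib_left right_diff_distrib)
  also have "norm (s *\<^sub>R x) = norm y" using False by (simp add: s_def)
  also have "?w * (2 * (norm y)\<^sup>2 + 2 * (norm y)\<^sup>2) = 2 * s * (2 * ?w * (norm x * norm y))"
    using False by (simp add: s_def power2_eq_square)
  finally show ?thesis using s by simp
qed auto

text \<open>The inequality \<open>w (T X - X T\<^sup>*) \<le> 2 \<parallel>T\<parallel> w X\<close> for \<open>T = z A\<close>. After a rotation, the absolute
  value of the form of \<open>T X - X T\<^sup>*\<close> at \<open>y\<close> is the real part of a polarized form of \<open>X\<close> at the pair
  \<open>y\<close>, \<open>T\<^sup>* y\<close>, to which the preceding bound applies.\<close>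

lemma twisted_commutator_le:
  fixes A X :: "'a::complex_hilbert \<Rightarrow>\<^sub>L 'a"
  assumes A: "A \<in> bounded_ops" and X: "X \<in> bounded_ops"
  shows "cmod (z * cinner (A (X y)) y - cnj z * cinner (X (adj A y)) y)
     \<le> 2 * (cmod z * norm A) * numerical_radius X * (norm y)\<^sup>2"
proof -
  let ?S = "z * cinner (A (X y)) y - cnj z * cinner (X (adj A y)) y"
  obtain c where c: "cmod c = 1" "c * ?S = of_real (cmod ?S)"
    using exists_phase by blast
  define u where "u = cnj z *\<^sub>C adj A y"
  have u: "norm u \<le> cmod z * (norm A * norm y)"
    by (simp add: u_def norm_scaleC mult_left_mono norm_adj_apply_le[OF A])
  \<comment> \<open>The factor \<open>-\<i>\<close> turns the difference into the sum to which the polarized bound applies.\<close>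
  define v where "v = (- \<i>) *\<^sub>C u"
  have S: "?S = - \<i> * (cinner (X y) v + cinner (X v) y)"
    by (simp add: v_def u_def cinner_simps bounded_ops_scaleC[OF X] cinner_adj[OF A] algebra_simps)
  have "of_real (cmod ?S) = c * ?S"
    by (rule c(2)[symmetric])
  also have "\<dots> = c * (- \<i> * (cinner (X y) v + cinner (X v) y))"
    by (rule arg_cong[OF S])
  also have "\<dots> = (- \<i> * c) * cinner (X y) v + (- \<i> * c) * cinner (X v) y"
    by (simp add: algebra_simps)
  finally have "of_real (cmod ?S) = (- \<i> * c) * cinner (X y) v + (- \<i> * c) * cinner (X v) y" .
  then have "Re (of_real (cmod ?S)) = Re ((- \<i> * c) * cinner (X y) v) + Re ((- \<i> * c) * cinner (X v) y)"
    by (metis plus_complex.sel(1))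
  also have "\<dots> \<le> 2 * numerical_radius X * (norm y * norm v)"
    by (rule Re_polar_bound) (simp add: norm_mult c)
  also have "\<dots> \<le> 2 * numerical_radius X * (norm y * (cmod z * (norm A * norm y)))"
    using u by (intro mult_left_mono) (auto simp: numerical_radius_nonneg v_def norm_scaleC)
  finally show ?thesis by (simp add: power2_eq_square algebra_simps)
qed

section \<open>Resolvents\<close>

lemma scalar_op_apply [simp]: "scalar_op z x = z *\<^sub>C x"
  by (simp add: scalar_op.rep_eq)

lemma inverse_op_unique:
  assumes "is_inverse_op T S" "is_inverse_op T S'"
  shows "S = S'"
proof -
  have "S = S o\<^sub>L id_blinfun" by (rule blinfun_eqI) simp
  also have "\<dots> = S o\<^sub>L (T o\<^sub>L S')" using assms by (simp add: is_inverse_op_def)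
  also have "\<dots> = (S o\<^sub>L T) o\<^sub>L S'" by (rule blinfun_eqI) simp
  also have "\<dots> = id_blinfun o\<^sub>L S'" using assms by (simp add: is_inverse_op_def)
  also have "\<dots> = S'" by (rule blinfun_eqI) simp
  finally show ?thesis .
qed

lemma is_inverse_resolvent:
  assumes "z \<notin> spectrum A"
  shows "is_inverse_op (scalar_op z - A) (resolvent A z)"
  unfolding resolvent_def
  by (rule theI') (use assms inverse_op_unique in \<open>auto simp: spectrum_def\<close>)

lemma resolvent_bounded_ops: "z \<notin> spectrum A \<Longrightarrow> resolvent A z \<in> bounded_ops"
  using is_inverse_resolvent is_inverse_op_def by blast

lemma resolvent_right:
  assumes "z \<notin> spectrum A"
  shows "z *\<^sub>C resolvent A z x - A (resolvent A z x) = x"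
proof -
  have "((scalar_op z - A) o\<^sub>L resolvent A z) x = x"
    using is_inverse_resolvent[OF assms] by (simp add: is_inverse_op_def)
  then show ?thesis by (simp add: blinfun.diff_left)
qed

lemma resolvent_left:
  assumes "z \<notin> spectrum A"
  shows "resolvent A z (z *\<^sub>C x - A x) = x"
proof -
  have "(resolvent A z o\<^sub>L (scalar_op z - A)) x = x"
    using is_inverse_resolvent[OF assms] by (simp add: is_inverse_op_def)
  then show ?thesis by (simp add: blinfun.diff_left)
qed

lemma resolvent_identity:
  assumes z: "z \<notin> spectrum A" and w: "w \<notin> spectrum A"
  shows "resolvent A z x - resolvent A w x = (w - z) *\<^sub>C resolvent A z (resolvent A w x)"
proof -
  let ?u = "resolvent A w x"
  have "x = (w *\<^sub>C ?u - A ?u)" by (simp add: resolvent_right[OF w])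
  also have "\<dots> = (w - z) *\<^sub>C ?u + (z *\<^sub>C ?u - A ?u)"
    using scaleC_add_left[of "w - z" z ?u] by simp
  finally have "resolvent A z x = resolvent A z ((w - z) *\<^sub>C ?u + (z *\<^sub>C ?u - A ?u))"
    by simp
  also have "\<dots> = (w - z) *\<^sub>C resolvent A z ?u + ?u"
    by (simp only: blinfun.add_right bounded_ops_scaleC[OF resolvent_bounded_ops[OF z]] resolvent_left[OF z])
  finally show ?thesis by simp
qed

lemma norm_resolvent_diff_le:
  assumes z: "z \<notin> spectrum A" and w: "w \<notin> spectrum A"
  shows "norm (resolvent A z - resolvent A w) \<le> cmod (z - w) * norm (resolvent A z) * norm (resolvent A w)"
proof (rule norm_blinfun_bound)
  fix x
  have "norm (resolvent A z (resolvent A w x)) \<le> norm (resolvent A z) * norm (resolvent A w x)"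
    by (rule norm_blinfun)
  also have "\<dots> \<le> norm (resolvent A z) * (norm (resolvent A w) * norm x)"
    by (intro mult_left_mono norm_blinfun) auto
  finally have "cmod (w - z) * norm (resolvent A z (resolvent A w x))
      \<le> cmod (w - z) * (norm (resolvent A z) * (norm (resolvent A w) * norm x))"
    by (rule mult_left_mono) simp
  then show "norm ((resolvent A z - resolvent A w) x)
      \<le> cmod (z - w) * norm (resolvent A z) * norm (resolvent A w) * norm x"
    by (simp add: blinfun.diff_left resolvent_identity[OF z w] norm_scaleC norm_minus_commute mult.assoc)
qed simp

lemma resolvent_nonzero:
  fixes A :: "'a::complex_hilbert \<Rightarrow>\<^sub>L 'a"
  assumes "z \<notin> spectrum A" and "(x::'a) \<noteq> 0"
  shows "resolvent A z \<noteq> 0"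
  using resolvent_right[OF assms(1), of x] assms(2) by auto

text \<open>Distances to the empty set are \<open>0\<close> by convention, so for an empty spectrum the \<open>G\<^sub>1\<close> condition
  would make all resolvents vanish. That is possible only on the zero space, whence the nonzero
  vector among the hypotheses here and below.\<close>

lemma G1_spectrum_nonempty:
  fixes A :: "'a::complex_hilbert \<Rightarrow>\<^sub>L 'a"
  assumes "G1_operator A" and "(x::'a) \<noteq> 0"
  shows "spectrum A \<noteq> {}"
proof
  assume e: "spectrum A = {}"
  then have "norm (resolvent A 0) = 0"
    using assms(1) unfolding G1_operator_def by (simp add: infdist_def)
  then show False using resolvent_nonzero[of 0 A x] assms(2) e by simp
qed

lemma G1_norm_resolvent:
  "G1_operator A \<Longrightarrow> z \<notin> spectrum A \<Longrightarrow> norm (resolvent A z) = 1 / infdist z (spectrum A)"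
  by (simp add: G1_operator_def)

text \<open>A resolvent is not \<open>0\<close>, so by the \<open>G\<^sub>1\<close> condition a point outside the spectrum has positive distance
  from it. For \<open>G\<^sub>1\<close> operators this replaces the usual argument by Neumann series.\<close>

lemma G1_spectrum_closed:
  fixes A :: "'a::complex_hilbert \<Rightarrow>\<^sub>L 'a"
  assumes G: "G1_operator A" and x: "(x::'a) \<noteq> 0"
  shows "closed (spectrum A)"
proof -
  have "z \<in> spectrum A" if "z \<in> closure (spectrum A)" for z
  proof (rule ccontr)
    assume z: "z \<notin> spectrum A"
    have "infdist z (spectrum A) = 0"
      using that G1_spectrum_nonempty[OF assms] in_closure_iff_infdist_zero by blast
    then show False
      using G1_norm_resolvent[OF G z] resolvent_nonzero[OF z x] by simp
  qed
  then show ?thesis by (metis closure_subset closure_closed subsetI subset_antisym closed_closure)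
qed

text \<open>The resolvent identity bounds differences of resolvents, and the \<open>G\<^sub>1\<close> condition keeps
  the norms in this bound locally finite.\<close>

lemma G1_resolvent_continuous:
  fixes A :: "'a::complex_hilbert \<Rightarrow>\<^sub>L 'a"
  assumes G: "G1_operator A" and x: "(x::'a) \<noteq> 0"
  shows "continuous_on (- spectrum A) (resolvent A)"
proof (rule continuous_on_eq_continuous_within[THEN iffD2], intro ballI)
  fix w assume w: "w \<in> - spectrum A"
  let ?\<sigma> = "spectrum A"
  have pos: "infdist w ?\<sigma> \<noteq> 0"
    using G1_norm_resolvent[OF G, of w] resolvent_nonzero[of w A x] w x by auto
  have "((\<lambda>z. resolvent A z - resolvent A w) \<longlongrightarrow> 0) (at w within - ?\<sigma>)"
  proof (rule tendsto_0_le[where K = 1])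
    have "((\<lambda>z. cmod (z - w) * (1 / infdist z ?\<sigma>) * norm (resolvent A w))
        \<longlongrightarrow> cmod (w - w) * (1 / infdist w ?\<sigma>) * norm (resolvent A w)) (at w within - ?\<sigma>)"
      by (intro tendsto_intros pos)
    then show "((\<lambda>z. cmod (z - w) * (1 / infdist z ?\<sigma>) * norm (resolvent A w)) \<longlongrightarrow> 0) (at w within - ?\<sigma>)"
      by simp
    show "\<forall>\<^sub>F z in at w within - ?\<sigma>. norm (resolvent A z - resolvent A w)
       \<le> norm (cmod (z - w) * (1 / infdist z ?\<sigma>) * norm (resolvent A w)) * 1"
      unfolding eventually_at_filter
    proof (intro always_eventually allI impI)
      fix z assume z: "z \<in> - ?\<sigma>"
      have "norm (resolvent A z - resolvent A w)
          \<le> cmod (z - w) * (1 / infdist z ?\<sigma>) * norm (resolvent A w)"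
        using norm_resolvent_diff_le[of z A w] z w by (simp add: G1_norm_resolvent[OF G, of z])
      then show "norm (resolvent A z - resolvent A w)
          \<le> norm (cmod (z - w) * (1 / infdist z ?\<sigma>) * norm (resolvent A w)) * 1"
        by (simp add: infdist_nonneg)
    qed
  qed
  then show "continuous (at w within - ?\<sigma>) (resolvent A)"
    unfolding continuous_within by (simp add: LIM_zero_iff)
qed

text \<open>The resolvent identity exhibits the difference quotient, and continuity gives its limit. Weak
  holomorphy is enough for everything that follows, since operators are determined by their
  matrix elements.\<close>

lemma G1_resolvent_weakly_holomorphic:
  fixes A :: "'a::complex_hilbert \<Rightarrow>\<^sub>L 'a"
  assumes G: "G1_operator A"
  shows "(\<lambda>z. cinner (resolvent A z x) y) holomorphic_on - spectrum A"
proof (cases "x = 0")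
  case False
  note op = open_Compl[OF G1_spectrum_closed[OF G False]]
  have "((\<lambda>z. cinner (resolvent A z x) y) has_field_derivative
      - cinner (resolvent A w (resolvent A w x)) y) (at w)" if w: "w \<notin> spectrum A" for w
  proof -
    have "(resolvent A \<longlongrightarrow> resolvent A w) (at w)"
      using G1_resolvent_continuous[OF G False] op w
      by (metis Compl_iff at_within_open continuous_on_def)
    then have "((\<lambda>z. resolvent A z (resolvent A w x)) \<longlongrightarrow> resolvent A w (resolvent A w x)) (at w)"
      by (intro tendsto_intros)
    then have "((\<lambda>z. - cinner (resolvent A z (resolvent A w x)) y)
        \<longlongrightarrow> - cinner (resolvent A w (resolvent A w x)) y) (at w)"
      by (intro tendsto_minus bounded_linear.tendsto[OF bounded_linear_cinner_left])
    then have "((\<lambda>z. (cinner (resolvent A z x) y - cinner (resolvent A w x) y) / (z - w))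
        \<longlongrightarrow> - cinner (resolvent A w (resolvent A w x)) y) (at w)"
    proof (rule Lim_transform_within_open[where s = "- spectrum A"])
      fix z assume z: "z \<in> - spectrum A" "z \<noteq> w"
      have "cinner (resolvent A z x) y - cinner (resolvent A w x) y
          = (w - z) * cinner (resolvent A z (resolvent A w x)) y"
        using resolvent_identity[of z A w x] z w by (simp flip: cinner_diff_left add: cinner_scaleC_left)
      then show "- cinner (resolvent A z (resolvent A w x)) y
          = (cinner (resolvent A z x) y - cinner (resolvent A w x) y) / (z - w)"
        using z by (simp add: field_simps)
    qed (use op w in auto)
    then show ?thesis by (simp add: has_field_derivative_iff)
  qed
  then show ?thesis
    by (auto simp: holomorphic_on_open[OF op])
qed (simp add: blinfun.zero_right)

section \<open>Contour integrals of operator-valued functions\<close>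

lemma blinfun_eq_weakI:
  fixes S T :: "'a::complex_hilbert \<Rightarrow>\<^sub>L 'a"
  assumes "\<And>x y. cinner (S x) y = cinner (T x) y"
  shows "S = T"
  by (rule blinfun_eqI[OF cinner_eqI]) (rule assms)

lemma bounded_linear_matrix_element: "bounded_linear (\<lambda>T::'a::complex_hilbert \<Rightarrow>\<^sub>L 'a. cinner (T x) y)"
  by (rule bounded_linear_compose[OF bounded_linear_cinner_left blinfun.bounded_linear_left])

lemma norm_scalar_op_compose_le: "norm (scalar_op z o\<^sub>L T) \<le> cmod z * norm T"
proof (rule norm_blinfun_bound)
  fix x
  show "norm ((scalar_op z o\<^sub>L T) x) \<le> cmod z * norm T * norm x"
    using mult_left_mono[OF norm_blinfun[of T x], of "cmod z"] by (simp add: norm_scaleC mult.assoc)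
qed simp

lemma scalar_op_compose_add: "scalar_op (z + w) o\<^sub>L T = (scalar_op z o\<^sub>L T) + (scalar_op w o\<^sub>L T)"
  by (rule blinfun_eqI) (simp add: blinfun.add_left scaleC_add_left)

lemma scalar_op_compose_scaleR:
  fixes T :: "'a::complex_hilbert \<Rightarrow>\<^sub>L 'a"
  shows "scalar_op (r *\<^sub>R z) o\<^sub>L T = r *\<^sub>R (scalar_op z o\<^sub>L T)"
  unfolding scaleR_conv_of_real
  by (rule blinfun_eqI) (simp add: blinfun.scaleR_left scaleR_scaleC[where 'a='a] scaleC_scaleC)

lemma scalar_op_compose_diff:
  fixes S T :: "'a::complex_hilbert \<Rightarrow>\<^sub>L 'a"
  shows "scalar_op z o\<^sub>L (S - T) = (scalar_op z o\<^sub>L S) - (scalar_op z o\<^sub>L T)"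
proof -
  have "z *\<^sub>C (a - b) = z *\<^sub>C a - z *\<^sub>C b" for a b :: 'a
    using scaleC_add_right[of z "a - b" b] by simp
  then show ?thesis by (intro blinfun_eqI) (simp add: blinfun.diff_left)
qed

lemma bounded_linear_scalar_op_compose:
  fixes T :: "'a::complex_hilbert \<Rightarrow>\<^sub>L 'a"
  shows "bounded_linear (\<lambda>z. scalar_op z o\<^sub>L T)"
  by (rule bounded_linear_intro[where K = "norm T"])
     (auto simp: scalar_op_compose_add scalar_op_compose_scaleR norm_scalar_op_compose_le)

lemma bounded_linear_compose_scalar_op: "bounded_linear (\<lambda>T. scalar_op z o\<^sub>L T)"
  by (rule bounded_bilinear.bounded_linear_right[OF bounded_bilinear_blinfun_compose])

text \<open>This reduces operator-valued contour integrals to scalar ones, provided that the former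
  converge.\<close>

lemma matrix_element_op_contour_integral:
  assumes "(\<lambda>t. scalar_op (vector_derivative \<gamma> (at t within {0..1})) o\<^sub>L G (\<gamma> t)) integrable_on {0..1}"
  shows "cinner (op_contour_integral \<gamma> G x) y = contour_integral \<gamma> (\<lambda>z. cinner (G z x) y)"
proof -
  have "((\<lambda>z. cinner (G z x) y) has_contour_integral cinner (op_contour_integral \<gamma> G x) y) \<gamma>"
    using has_integral_linear[OF integrable_integral[OF assms] bounded_linear_matrix_element[of x y]]
    by (simp add: has_contour_integral_def op_contour_integral_def o_def cinner_scaleC_left mult.commute)
  then show ?thesis by (rule contour_integral_unique[symmetric])
qed

lemma integrable_linepath_op:
  assumes "continuous_on (closed_segment a b) G"
  shows "(\<lambda>t. scalar_op (vector_derivative (linepath a b) (at t within {0..1})) o\<^sub>L G (linepath a b t)) integrable_on {0..1}"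
proof (rule integrable_eq)
  have "continuous_on {0..1} (\<lambda>t. G (linepath a b t))"
    by (rule continuous_on_compose2[OF assms]) (auto simp: linepath_in_path)
  then show "(\<lambda>t. scalar_op (b - a) o\<^sub>L G (linepath a b t)) integrable_on {0..1}"
    by (intro integrable_continuous_interval
        bounded_linear.continuous_on[OF bounded_linear_compose_scalar_op])
qed (simp add: vector_derivative_linepath_within)

text \<open>The integral of \<open>G\<close> along the segment from a fixed base point is a primitive in the operator norm.
  The triangle identity behind this is an equality of operators, so it may be checked on matrix
  elements, where it is Cauchy's theorem; norm continuity of \<open>G\<close> then gives the
  derivative.\<close>

lemma weakly_holomorphic_primitive:
  fixes G :: "complex \<Rightarrow> 'a::complex_hilbert \<Rightarrow>\<^sub>L 'a"
  assumes D: "open D" "convex D" and G: "continuous_on D G"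
    and hol: "\<And>x y. (\<lambda>z. cinner (G z x) y) holomorphic_on D"
  shows "\<exists>P. \<forall>z\<in>D. (P has_derivative (\<lambda>h. scalar_op h o\<^sub>L G z)) (at z)"
proof (cases "D = {}")
  case False
  then obtain z0 where z0: "z0 \<in> D" by blast
  define L where "L = (\<lambda>a b. op_contour_integral (linepath a b) G)"
  have seg: "closed_segment a b \<subseteq> D" if "a \<in> D" "b \<in> D" for a b
    using that D by (simp add: closed_segment_subset)
  have int: "(\<lambda>t. scalar_op (vector_derivative (linepath a b) (at t within {0..1})) o\<^sub>L G (linepath a b t)) integrable_on {0..1}"
    if "a \<in> D" "b \<in> D" for a b
    by (rule integrable_linepath_op) (use continuous_on_subset[OF G seg[OF that]] in auto)
  have L: "cinner (L a b x) y = contour_integral (linepath a b) (\<lambda>z. cinner (G z x) y)"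
    if "a \<in> D" "b \<in> D" for a b x y
    unfolding L_def by (rule matrix_element_op_contour_integral[OF int[OF that]])
  have tri: "L z0 b - L z0 a = L a b" if "a \<in> D" "b \<in> D" for a b
  proof (rule blinfun_eq_weakI)
    fix x y
    obtain p where p: "\<And>z. z \<in> D \<Longrightarrow> (p has_field_derivative cinner (G z x) y) (at z within D)"
      using holomorphic_convex_primitive'[OF D(2,1) hol[of x y]] by blast
    have ci: "contour_integral (linepath u v) (\<lambda>z. cinner (G z x) y) = p v - p u"
      if "u \<in> D" "v \<in> D" for u v
      using contour_integral_primitive[of D p "\<lambda>z. cinner (G z x) y" "linepath u v"] p seg[OF that]
      by (auto intro!: contour_integral_unique)
    show "cinner ((L z0 b - L z0 a) x) y = cinner (L a b x) y"
      using that z0 by (simp add: blinfun.diff_left cinner_diff_left L ci)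
  qed
  have "(L z0 has_derivative (\<lambda>h. scalar_op h o\<^sub>L G w)) (at w)" if w: "w \<in> D" for w
    unfolding has_derivative_at_alt
  proof (intro conjI allI impI bounded_linear_scalar_op_compose)
    fix e :: real assume e: "e > 0"
    have "continuous (at w) G" using G D w by (simp add: continuous_on_eq_continuous_at)
    then obtain d1 where d1: "d1 > 0" "\<And>z. dist z w < d1 \<Longrightarrow> dist (G z) (G w) < e"
      using e unfolding continuous_at_eps_delta by blast
    obtain d2 where d2: "d2 > 0" "ball w d2 \<subseteq> D" using D w open_contains_ball by blast
    have "norm (L z0 z - L z0 w - (scalar_op (z - w) o\<^sub>L G w)) \<le> e * norm (z - w)"
      if z: "norm (z - w) < min d1 d2" for z
    proof -
      have zD: "z \<in> D" using d2 z by (auto simp: dist_norm norm_minus_commute)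
      let ?h = "\<lambda>t. (scalar_op (vector_derivative (linepath w z) (at t within {0..1})) o\<^sub>L G (linepath w z t))
          - (scalar_op (z - w) o\<^sub>L G w)"
      have "((\<lambda>t. scalar_op (vector_derivative (linepath w z) (at t within {0..1})) o\<^sub>L G (linepath w z t))
          has_integral L w z) {0..1}"
        unfolding L_def op_contour_integral_def by (rule integrable_integral[OF int[OF w zD]])
      moreover have "((\<lambda>t::real. scalar_op (z - w) o\<^sub>L G w) has_integral (1 - 0) *\<^sub>R (scalar_op (z - w) o\<^sub>L G w)) {0..1}"
        using has_integral_const_real[of "scalar_op (z - w) o\<^sub>L G w" 0 1] by simp
      ultimately have "(?h has_integral (L w z - (scalar_op (z - w) o\<^sub>L G w))) (cbox 0 1)"
        by (simp add: has_integral_diff)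
      then have "norm (L w z - (scalar_op (z - w) o\<^sub>L G w)) \<le> (e * norm (z - w)) * measure lborel (cbox 0 (1::real))"
      proof (rule has_integral_bound[rotated])
        fix t :: real assume t: "t \<in> cbox 0 1"
        have "dist (linepath w z t) w = t * norm (z - w)"
          using t by (simp add: linepath_def dist_norm algebra_simps flip: scaleR_diff_right)
        also have "\<dots> \<le> norm (z - w)" using t by (simp add: mult_left_le_one_le)
        finally have "norm (G (linepath w z t) - G w) \<le> e"
          using d1(2)[of "linepath w z t"] z by (simp add: dist_norm less_imp_le)
        then have "norm (scalar_op (z - w) o\<^sub>L (G (linepath w z t) - G w)) \<le> norm (z - w) * e"
          using norm_scalar_op_compose_le[of "z - w" "G (linepath w z t) - G w"]
          by (meson mult_left_mono norm_ge_zero order_trans)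
        then show "norm (?h t) \<le> e * norm (z - w)"
          using t by (simp add: vector_derivative_linepath_within scalar_op_compose_diff mult.commute)
      qed (use e in simp)
      then show ?thesis using tri[OF w zD] by simp
    qed
    moreover have "min d1 d2 > 0" using d1 d2 by simp
    ultimately show "\<exists>d>0. \<forall>y. norm (y - w) < d \<longrightarrow>
        norm (L z0 y - L z0 w - (scalar_op (y - w) o\<^sub>L G w)) \<le> e * norm (y - w)"
      by blast
  qed
  then show ?thesis by blast
qed auto

text \<open>A valid path is continuously differentiable only off a finite set, and its derivative may be
  unbounded there; the integrand need not even be absolutely integrable. The integral exists
  as a gauge integral because the integrand is locally the derivative of \<open>P \<circ> \<gamma>\<close> for a local
  primitive \<open>P\<close>.\<close>

lemma integrable_op_contour:
  fixes G :: "complex \<Rightarrow> 'a::complex_hilbert \<Rightarrow>\<^sub>L 'a"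
  assumes \<Omega>: "open \<Omega>" and G: "continuous_on \<Omega> G"
    and hol: "\<And>x y. (\<lambda>z. cinner (G z x) y) holomorphic_on \<Omega>"
    and \<gamma>: "valid_path \<gamma>" "path_image \<gamma> \<subseteq> \<Omega>"
  shows "(\<lambda>t. scalar_op (vector_derivative \<gamma> (at t within {0..1})) o\<^sub>L G (\<gamma> t)) integrable_on {0..1}"
proof -
  let ?g = "\<lambda>t. scalar_op (vector_derivative \<gamma> (at t within {0..1})) o\<^sub>L G (\<gamma> t)"
  obtain S where S: "finite S" "\<And>t. t \<in> {0..1} - S \<Longrightarrow> \<gamma> differentiable (at t)"
    using \<gamma>(1) unfolding valid_path_def piecewise_C1_differentiable_on_def C1_differentiable_on_eq by blast
  have cont: "continuous_on {0..1} \<gamma>"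
    using valid_path_imp_path[OF \<gamma>(1)] by (simp add: path_def)
  have "?g integrable_on cbox 0 1"
  proof (rule integrable_on_little_subintervals, intro ballI)
    fix t0 :: real assume t0: "t0 \<in> cbox 0 1"
    then have "\<gamma> t0 \<in> \<Omega>" using \<gamma>(2) by (auto simp: path_image_def)
    then obtain r where r: "r > 0" "ball (\<gamma> t0) r \<subseteq> \<Omega>" using \<Omega> open_contains_ball by blast
    obtain P where P: "\<And>z. z \<in> ball (\<gamma> t0) r \<Longrightarrow> (P has_derivative (\<lambda>h. scalar_op h o\<^sub>L G z)) (at z)"
      using weakly_holomorphic_primitive[of "ball (\<gamma> t0) r" G] continuous_on_subset[OF G r(2)]
        holomorphic_on_subset[OF hol r(2)] by blast
    obtain d where d: "d > 0" "\<And>t. t \<in> {0..1} \<Longrightarrow> dist t t0 < d \<Longrightarrow> dist (\<gamma> t) (\<gamma> t0) < r"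
      using cont t0 r(1) unfolding continuous_on_iff by (metis cbox_interval)
    have "?g integrable_on cbox u v"
      if uv: "t0 \<in> cbox u v" "cbox u v \<subseteq> ball t0 d" "cbox u v \<subseteq> cbox 0 1" for u v
    proof -
      have in_ball: "\<gamma> t \<in> ball (\<gamma> t0) r" if "t \<in> {u..v}" for t
        using d(2)[of t] that uv by (auto simp: dist_commute subset_iff)
      have "(?g has_integral ((P \<circ> \<gamma>) v - (P \<circ> \<gamma>) u)) {u..v}"
      proof (rule fundamental_theorem_of_calculus_interior_strong[OF S(1)])
        show "u \<le> v" using uv by auto
        have "{u..v} \<subseteq> {0..1}" using uv by simp
        then have "continuous_on {u..v} \<gamma>" by (rule continuous_on_subset[OF cont])
        moreover have "continuous_on (ball (\<gamma> t0) r) P"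
          by (meson P differentiable_imp_continuous_on differentiable_on_def differentiable_at_withinI differentiableI)
        moreover have "\<gamma> ` {u..v} \<subseteq> ball (\<gamma> t0) r" using in_ball by blast
        ultimately show "continuous_on {u..v} (P \<circ> \<gamma>)"
          using continuous_on_compose continuous_on_subset by blast
        fix t assume t: "t \<in> {u<..<v} - S"
        have "0 \<le> u \<and> v \<le> 1" using uv by auto
        then have tt: "t \<in> {0<..<1}" using t by auto
        have "(\<gamma> has_vector_derivative vector_derivative \<gamma> (at t)) (at t)"
          using S(2)[of t] t tt by (simp add: vector_derivative_works)
        moreover from this have "vector_derivative \<gamma> (at t within {0..1}) = vector_derivative \<gamma> (at t)"
          by (rule vector_derivative_at_within_ivl) (use tt in auto)
        ultimately have "(\<gamma> has_vector_derivative vector_derivative \<gamma> (at t within {0..1})) (at t)"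
          by simp
        then have "(\<gamma> has_derivative (\<lambda>s. s *\<^sub>R vector_derivative \<gamma> (at t within {0..1}))) (at t)"
          by (simp add: has_vector_derivative_def)
        from has_derivative_compose[OF this P] in_ball[of t] t
        have "((\<lambda>s. P (\<gamma> s)) has_derivative
            (\<lambda>s. scalar_op (s *\<^sub>R vector_derivative \<gamma> (at t within {0..1})) o\<^sub>L G (\<gamma> t))) (at t)"
          by auto
        then show "((P \<circ> \<gamma>) has_vector_derivative ?g t) (at t)"
          by (simp add: has_vector_derivative_def o_def scalar_op_compose_scaleR)
      qed
      then show ?thesis by (auto simp: integrable_on_def)
    qed
    then show "\<exists>d>0. \<forall>u v. t0 \<in> cbox u v \<and> cbox u v \<subseteq> ball t0 d \<and> cbox u v \<subseteq> cbox 0 1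
        \<longrightarrow> ?g integrable_on cbox u v"
      using d(1) by blast
  qed
  then show ?thesis by simp
qed

section \<open>Deforming the contour to a circle\<close>

text \<open>The loop that runs along \<open>\<gamma>\<close>, along a link \<open>h\<close> to the circle, backwards around the circle and
  back along \<open>h\<close> has winding number \<open>0\<close> about every point of \<open>K\<close> and about every point off the unit disc,
  so the homology form of Cauchy's theorem applies. The link has to avoid \<open>K\<close> and stay in the disc:
  by the Jordan curve theorem the outside of \<open>\<gamma>\<close> together with \<open>\<gamma>\<close> is connected, and it is disjoint
  from \<open>K\<close>. The radial retraction onto the closed disc of radius \<open>r\<close> moves it into the unit disc
  without meeting \<open>K\<close>.\<close>

lemma contour_integral_eq_circlepath:
  assumes \<gamma>: "surrounding_contour (ball 0 1) K \<gamma>" and K: "closed K"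
    and r: "r < 1" "K \<subseteq> ball 0 r" "path_image \<gamma> \<subseteq> ball 0 r"
    and F: "F holomorphic_on ball 0 1 - K"
  shows "contour_integral \<gamma> F = contour_integral (circlepath 0 r) F"
proof -
  define S where "S = ball 0 1 - K"
  define p where "p = pathstart \<gamma>"
  let ?out = "outside (path_image \<gamma>)"
  have g: "valid_path \<gamma>" "simple_path \<gamma>" "pathfinish \<gamma> = p" "pathstart \<gamma> = p"
      "K \<subseteq> inside (path_image \<gamma>)" "\<And>z. z \<in> inside (path_image \<gamma>) \<Longrightarrow> winding_number \<gamma> z = 1"
    using \<gamma> by (auto simp: surrounding_contour_def p_def)
  have p: "p \<in> path_image \<gamma>" by (auto simp: p_def)
  then have pr: "norm p < r" using r by auto
  then have r0: "r > 0" using norm_ge_zero[of p] by linarith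
  have openS: "open S" using K by (auto simp: S_def)
  have dK: "z \<notin> K" if "z \<in> ?out \<union> path_image \<gamma>" for z
    using that g(5) inside_Int_outside[of "path_image \<gamma>"] inside_no_overlap[of "path_image \<gamma>"] by blast
  have conn: "connected (?out \<union> path_image \<gamma>)"
  proof -
    have "closure ?out = ?out \<union> path_image \<gamma>"
      using Jordan_inside_outside[of \<gamma>] g by (metis closure_Un_frontier)
    then show ?thesis
      using Jordan_inside_outside[of \<gamma>] g by (metis connected_imp_connected_closure)
  qed
  have nz: "max r (cmod z) \<noteq> 0" for z using r0 by (auto simp: max_def)
  define \<phi> where "\<phi> = (\<lambda>z::complex. (r / max r (cmod z)) *\<^sub>R z)"
  have "connected_component S p (of_real r)"
    unfolding connected_component_def
  proof (intro exI conjI)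
    have "continuous_on (?out \<union> path_image \<gamma>) \<phi>"
      unfolding \<phi>_def by (intro continuous_intros ballI nz)
    then show "connected (\<phi> ` (?out \<union> path_image \<gamma>))"
      using conn by (rule connected_continuous_image)
    show "\<phi> ` (?out \<union> path_image \<gamma>) \<subseteq> S"
    proof (rule image_subsetI)
      fix z assume z: "z \<in> ?out \<union> path_image \<gamma>"
      show "\<phi> z \<in> S"
      proof (cases "cmod z \<le> r")
        case True
        then have "\<phi> z = z" using r0 by (simp add: \<phi>_def max_def)
        then show ?thesis using dK[OF z] True r(1) by (simp add: S_def)
      next
        case False
        then have "norm (\<phi> z) = r" using r0 by (cases "z = 0") (auto simp: \<phi>_def max_def)
        then show ?thesis using r by (auto simp: S_def)
      qed
    qed
    have "\<phi> p = p" using pr r0 by (simp add: \<phi>_def max_def)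
    then show "p \<in> \<phi> ` (?out \<union> path_image \<gamma>)" using p by force
    have "path_image \<gamma> \<subseteq> ball 0 1" using r by auto
    then have "1 \<in> ?out"
      using outside_subset_convex[of "ball (0::complex) 1" "path_image \<gamma>"] by auto
    moreover have "\<phi> 1 = of_real r" using r by (simp add: \<phi>_def max_def scaleR_conv_of_real)
    ultimately show "of_real r \<in> \<phi> ` (?out \<union> path_image \<gamma>)" by force
  qed
  moreover have "p \<in> S" using p r dK by (auto simp: S_def)
  ultimately obtain h where h: "polynomial_function h" "path_image h \<subseteq> connected_component_set S p"
      "pathstart h = p" "pathfinish h = of_real r"
    using connected_open_polynomial_connected[of "connected_component_set S p" p "of_real r"]
      open_connected_component[OF openS] by auto
  have hv: "valid_path h" by (rule valid_path_polynomial_function[OF h(1)])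
  have hS: "path_image h \<subseteq> S" using h(2) connected_component_subset by blast
  have gS: "path_image \<gamma> \<subseteq> S" using r dK by (auto simp: S_def)
  have cS: "path_image (circlepath 0 r) \<subseteq> S" using r r0 by (auto simp: S_def)
  let ?L = "\<gamma> +++ (h +++ (reversepath (circlepath 0 r) +++ reversepath h))"
  have ci: "F contour_integrable_on q" if "valid_path q" "path_image q \<subseteq> S" for q
    using contour_integrable_holomorphic_simple[of F S q] F openS that by (simp add: S_def)
  have "(F has_contour_integral 0) ?L"
  proof (rule Cauchy_theorem_global[of S])
    show "F holomorphic_on S" using F by (simp add: S_def)
    show "valid_path ?L" using g h hv by (auto intro!: valid_path_join)
    show "path_image ?L \<subseteq> S" using hS gS cS g h by (simp add: path_image_join)
    fix w assume w: "w \<notin> S"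
    have wn: "w \<notin> path_image \<gamma>" "w \<notin> path_image h" "w \<notin> path_image (circlepath 0 r)"
      using w hS gS cS by auto
    have "winding_number ?L w = winding_number \<gamma> w - winding_number (circlepath 0 r) w"
      using wn g h hv by (simp add: winding_number_join winding_number_reversepath path_image_join valid_path_imp_path
          not_in_path_image_join)
    also have "\<dots> = 0"
    proof (cases "w \<in> K")
      case True
      then have "winding_number (circlepath 0 r) w = 1"
        using r by (intro winding_number_circlepath) auto
      then show ?thesis using g True by auto
    next
      case False
      then have "w \<notin> ball 0 1" using w by (auto simp: S_def)
      then have "winding_number \<gamma> w = 0" "winding_number (circlepath 0 r) w = 0"
        using r r0 g by (auto intro!: winding_number_zero_outside[of _ "ball 0 1"] simp: valid_path_imp_path)
      then show ?thesis by simp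
    qed
    finally show "winding_number ?L w = 0" .
  qed (use openS g h in auto)
  then have "contour_integral ?L F = 0" by (rule contour_integral_unique)
  moreover have "contour_integral ?L F = contour_integral \<gamma> F - contour_integral (circlepath 0 r) F"
    using g h hv hS gS cS by (simp add: contour_integral_reversepath ci contour_integrable_reversepath
      contour_integrable_joinI valid_path_join)
  ultimately show ?thesis by simp
qed

lemma compact_subset_smaller_ball:
  fixes K :: "complex set"
  assumes "compact K" "K \<subseteq> ball 0 1"
  obtains r where "0 < r" "r < 1" "K \<subseteq> ball 0 r"
proof (cases "K = {}")
  case True
  then show ?thesis using that[of "1/2"] by simp
next
  case False
  obtain m where m: "m \<in> K" "\<And>z. z \<in> K \<Longrightarrow> norm z \<le> norm m"
    using continuous_attains_sup[of K norm] assms(1) False by (auto intro: continuous_intros)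
  then have "norm m < 1" using assms(2) by auto
  moreover from this have "K \<subseteq> ball 0 ((1 + norm m) / 2)"
    using m(2) by force
  moreover have "0 < (1 + norm m) / 2"
    by (simp add: add_pos_nonneg)
  ultimately show ?thesis
    using that[of "(1 + norm m) / 2"] by simp
qed

lemma surrounding_contour_exists:
  assumes "compact K" "K \<subseteq> ball 0 1"
  shows "\<exists>\<gamma>. surrounding_contour (ball 0 1) K \<gamma>"
proof -
  obtain r where r: "0 < r" "r < 1" "K \<subseteq> ball 0 r"
    using compact_subset_smaller_ball[OF assms] by blast
  have ins: "inside (sphere 0 r) = ball (0::complex) r"
    using inside_frontier_eq_interior[of "cball (0::complex) r"] r by simp
  have "surrounding_contour (ball 0 1) K (circlepath 0 r)"
    unfolding surrounding_contour_def using r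
    by (auto simp: simple_path_circlepath ins intro!: winding_number_circlepath)
  then show ?thesis by blast
qed

section \<open>The functional calculus as a circle integral\<close>

text \<open>The contour that defines \<open>f(A)\<close> is an unspecified one, so \<open>\<rho>\<close> has to be chosen such that the disc of
  radius \<open>\<rho>\<close> contains that contour as well as the spectrum.\<close>

lemma riesz_dunford_matrix_element:
  fixes A :: "'a::complex_hilbert \<Rightarrow>\<^sub>L 'a"
  assumes G: "G1_operator A" and x0: "(x0::'a) \<noteq> 0"
    and \<sigma>: "spectrum A \<subseteq> ball 0 1" and f: "f holomorphic_on ball 0 1"
  obtains \<rho> where "0 < \<rho>" "\<rho> < 1" "spectrum A \<subseteq> ball 0 \<rho>"
    "\<And>r x y. \<rho> < r \<Longrightarrow> r < 1 \<Longrightarrow> cinner (riesz_dunford (ball 0 1) f A x) y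
        = 1 / (2 * of_real pi * \<i>) * contour_integral (circlepath 0 r) (\<lambda>z. f z * cinner (resolvent A z x) y)"
proof -
  define \<gamma> where "\<gamma> = (SOME \<gamma>. surrounding_contour (ball 0 1) (spectrum A) \<gamma>)"
  let ?G = "\<lambda>z. scalar_op (f z) o\<^sub>L resolvent A z"
  let ?D = "ball 0 1 - spectrum A"
  have cl: "closed (spectrum A)" by (rule G1_spectrum_closed[OF G x0])
  have "compact (spectrum A)"
    using cl bounded_subset[OF bounded_ball \<sigma>] compact_eq_bounded_closed by blast
  then have \<gamma>: "surrounding_contour (ball 0 1) (spectrum A) \<gamma>"
    unfolding \<gamma>_def by (intro someI_ex[OF surrounding_contour_exists] \<sigma>)
  then have vp: "valid_path \<gamma>" and img: "path_image \<gamma> \<subseteq> ball 0 1"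
    and sub: "spectrum A \<subseteq> inside (path_image \<gamma>)"
    by (auto simp: surrounding_contour_def)
  have imgD: "path_image \<gamma> \<subseteq> ?D"
    using img sub inside_no_overlap[of "path_image \<gamma>"] by blast
  have "compact (spectrum A \<union> path_image \<gamma>)"
    using \<open>compact (spectrum A)\<close> vp by (intro compact_Un compact_path_image valid_path_imp_path)
  then obtain \<rho> where \<rho>: "0 < \<rho>" "\<rho> < 1" "spectrum A \<union> path_image \<gamma> \<subseteq> ball 0 \<rho>"
    using compact_subset_smaller_ball[of "spectrum A \<union> path_image \<gamma>"] \<sigma> img by blast
  have hol: "(\<lambda>z. f z * cinner (resolvent A z x) y) holomorphic_on ?D" for x y
    by (intro holomorphic_on_mult holomorphic_on_subset[OF f]
        holomorphic_on_subset[OF G1_resolvent_weakly_holomorphic[OF G]]) auto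
  have "continuous_on ?D ?G"
  proof -
    have c: "continuous_on ?D (resolvent A)" "continuous_on ?D f"
      using G1_resolvent_continuous[OF G x0] f
      by (auto intro: continuous_on_subset holomorphic_on_imp_continuous_on)
    have "continuous_on ?D (\<lambda>z. scalar_op (f z) o\<^sub>L id_blinfun)"
      by (rule bounded_linear.continuous_on[OF bounded_linear_scalar_op_compose c(2)])
    then have "continuous_on ?D (\<lambda>z. (scalar_op (f z) o\<^sub>L id_blinfun) o\<^sub>L resolvent A z)"
      by (rule bounded_bilinear.continuous_on[OF bounded_bilinear_blinfun_compose _ c(1)])
    moreover have "(scalar_op (f z) o\<^sub>L id_blinfun) o\<^sub>L resolvent A z = ?G z" for z
      by (rule blinfun_eqI) simp
    ultimately show ?thesis by simp
  qed
  then have int: "(\<lambda>t. scalar_op (vector_derivative \<gamma> (at t within {0..1})) o\<^sub>L ?G (\<gamma> t)) integrable_on {0..1}"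
    by (rule integrable_op_contour[rotated])
       (use vp imgD hol cl in \<open>auto simp: cinner_scaleC_left\<close>)
  have "cinner (riesz_dunford (ball 0 1) f A x) y
      = 1 / (2 * of_real pi * \<i>) * contour_integral (circlepath 0 r) (\<lambda>z. f z * cinner (resolvent A z x) y)"
    if r: "\<rho> < r" "r < 1" for r x y
  proof -
    have "cinner (riesz_dunford (ball 0 1) f A x) y
        = 1 / (2 * of_real pi * \<i>) * cinner (op_contour_integral \<gamma> ?G x) y"
      by (simp add: riesz_dunford_def Let_def \<gamma>_def cinner_scaleC_left)
    also have "cinner (op_contour_integral \<gamma> ?G x) y = contour_integral \<gamma> (\<lambda>z. f z * cinner (resolvent A z x) y)"
      by (simp add: matrix_element_op_contour_integral[OF int] cinner_scaleC_left)
    also have "\<dots> = contour_integral (circlepath 0 r) (\<lambda>z. f z * cinner (resolvent A z x) y)"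
    proof (rule contour_integral_eq_circlepath[OF \<gamma> cl r(2) _ _ hol])
      have "ball (0::complex) \<rho> \<subseteq> ball 0 r" using r(1) by auto
      then show "spectrum A \<subseteq> ball 0 r" "path_image \<gamma> \<subseteq> ball 0 r" using \<rho>(3) by blast+
    qed
    finally show ?thesis .
  qed
  then show ?thesis using that[of \<rho>] \<rho> by blast
qed

lemma has_contour_integral_circle_mean:
  assumes "(F has_contour_integral I) (circlepath 0 r)"
  shows "((\<lambda>t. F (circlepath 0 r t) * circlepath 0 r t) has_integral I / (2 * of_real pi * \<i>)) {0..1}"
proof -
  define k :: complex where "k = 2 * of_real pi * \<i>"
  have k: "k \<noteq> 0" by (simp add: k_def)
  have "vector_derivative (circlepath 0 r) (at t) = k * circlepath 0 r t" for t
    unfolding vector_derivative_circlepath k_def by (simp add: circlepath)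
  then have "((\<lambda>t. F (circlepath 0 r t) * (k * circlepath 0 r t)) has_integral I) {0..1}"
    using assms by (simp add: has_contour_integral)
  from has_integral_divide[OF this, of k] show ?thesis
    unfolding k_def[symmetric] using k by (simp add: mult.left_commute)
qed

lemma holomorphic_circle_mean:
  assumes F: "F holomorphic_on cball 0 r" and r: "r > 0"
  shows "((\<lambda>t. F (circlepath 0 r t)) has_integral F 0) {0..1}"
proof -
  have "((\<lambda>u. F u / (u - 0)) has_contour_integral 2 * of_real pi * \<i> * F 0) (circlepath 0 r)"
    by (rule Cauchy_integral_circlepath_simple[OF F]) (use r in simp)
  from has_contour_integral_circle_mean[OF this] show ?thesis
    using r by (simp add: circlepath)
qed

text \<open>Here \<open>w \<mapsto> s / cnj w\<close> is the reflection in the circle of radius \<open>sqrt s\<close>. It turns the behaviour of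
  \<open>z (z - A)\<^sup>-\<^sup>1 = I + A (z - A)\<^sup>-\<^sup>1\<close> near infinity into the behaviour near \<open>0\<close>; the singularity there is
  removable because \<open>(z - A)\<^sup>-\<^sup>1\<close> tends to \<open>0\<close> at infinity, by the \<open>G\<^sub>1\<close> condition.\<close>

lemma reflected_resolvent_holomorphic:
  fixes A :: "'a::complex_hilbert \<Rightarrow>\<^sub>L 'a"
  assumes G: "G1_operator A" and x0: "(x0::'a) \<noteq> 0"
    and \<rho>: "0 < \<rho>" "spectrum A \<subseteq> ball 0 \<rho>" and s: "0 < s"
  defines "q \<equiv> \<lambda>w. of_real s / cnj w"
  shows "(\<lambda>w. if w = 0 then cnj (cinner x y) else cnj (q w * cinner (resolvent A (q w) x) y))
           holomorphic_on ball 0 (s / \<rho>)"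
proof (rule no_isolated_singularity'[where K = "{0}"])
  let ?D = "ball (0::complex) (s / \<rho>)"
  let ?K = "\<lambda>w. if w = 0 then cnj (cinner x y) else cnj (q w * cinner (resolvent A (q w) x) y)"
  define H where "H = (\<lambda>z. z * cinner (resolvent A z x) y)"
  have nq: "cmod (q w) = s / cmod w" for w using s by (simp add: q_def norm_divide)
  have big: "\<rho> < cmod (q w)" if "w \<in> ?D - {0}" for w
    using that s \<rho> by (simp add: nq field_simps)
  have q\<sigma>: "q w \<notin> spectrum A" if "w \<in> ?D - {0}" for w
    using big[OF that] \<rho> by (auto simp: subset_iff)
  have cl: "closed (spectrum A)" by (rule G1_spectrum_closed[OF G x0])
  have "H holomorphic_on - spectrum A"
    unfolding H_def by (intro holomorphic_on_mult G1_resolvent_weakly_holomorphic[OF G]) (auto intro: holomorphic_intros)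
  moreover have inv: "cnj ` (cnj ` (- spectrum A)) = - spectrum A" by (auto simp: image_image)
  moreover have "open (cnj ` (- spectrum A))"
  proof -
    have "cnj ` (- spectrum A) = cnj -` (- spectrum A)"
      by (auto simp: image_iff) (metis ComplI complex_cnj_cnj)
    then show ?thesis
      using cl by (auto intro!: open_vimage continuous_intros)
  qed
  ultimately have "cnj \<circ> H \<circ> cnj holomorphic_on cnj ` (- spectrum A)"
    by (intro holomorphic_on_compose_cnj_cnj) simp_all
  moreover have "(\<lambda>w. of_real s / w) holomorphic_on ?D - {0}"
    by (intro holomorphic_intros) auto
  moreover have "(\<lambda>w. of_real s / w) ` (?D - {0}) \<subseteq> cnj ` (- spectrum A)"
  proof
    fix u assume "u \<in> (\<lambda>w. of_real s / w) ` (?D - {0})"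
    then obtain w where w: "w \<in> ?D - {0}" "u = of_real s / w" by blast
    then have "u = cnj (q w)" by (simp add: q_def)
    with q\<sigma>[OF w(1)] show "u \<in> cnj ` (- spectrum A)" by blast
  qed
  ultimately have "((cnj \<circ> H \<circ> cnj) \<circ> (\<lambda>w. of_real s / w)) holomorphic_on ?D - {0}"
    by (metis holomorphic_on_compose holomorphic_on_subset)
  then show "?K holomorphic_on ?D - {0}"
    by (rule holomorphic_transform) (auto simp: H_def q_def)
  fix z :: complex assume "z \<in> {0}"
  then have z: "z = 0" by simp
  let ?c = "norm A * norm x * norm y"
  have bound: "norm (?K w - ?K 0) \<le> cmod w * ?c / (s - \<rho> * cmod w)" if w: "w \<in> ?D - {0}" for w
  proof -
    let ?R = "resolvent A (q w)"
    have ne: "spectrum A \<noteq> {}" by (rule G1_spectrum_nonempty[OF G x0])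
    have "cmod (q w) - \<rho> \<le> infdist (q w) (spectrum A)"
      unfolding infdist_notempty[OF ne]
    proof (rule cINF_greatest[OF ne])
      fix a assume "a \<in> spectrum A"
      then have "cmod a < \<rho>" using \<rho> by auto
      then show "cmod (q w) - \<rho> \<le> dist (q w) a"
        using norm_triangle_ineq2[of "q w" a] by (simp add: dist_norm)
    qed
    then have "norm ?R \<le> 1 / (cmod (q w) - \<rho>)"
      unfolding G1_norm_resolvent[OF G q\<sigma>[OF w]] using big[OF w] by (intro divide_left_mono) (auto intro: mult_pos_pos)
    also have "\<dots> = cmod w / (s - \<rho> * cmod w)"
      using w by (simp add: nq field_simps)
    finally have R: "norm ?R \<le> cmod w / (s - \<rho> * cmod w)" .
    have "?K w - ?K 0 = cnj (cinner (q w *\<^sub>C ?R x - x) y)"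
      using w by (simp add: cinner_diff_left cinner_scaleC_left)
    also have "q w *\<^sub>C ?R x - x = A (?R x)"
      using resolvent_right[OF q\<sigma>[OF w], of x] by (simp add: algebra_simps)
    finally have "norm (?K w - ?K 0) = cmod (cinner (A (?R x)) y)" by simp
    also have "\<dots> \<le> norm (A (?R x)) * norm y" by (rule cinner_Cauchy_Schwarz)
    also have "\<dots> \<le> (norm A * (norm ?R * norm x)) * norm y"
      by (intro mult_right_mono order_trans[OF norm_blinfun] mult_left_mono norm_blinfun) auto
    also have "\<dots> = norm ?R * ?c" by simp
    also have "\<dots> \<le> cmod w / (s - \<rho> * cmod w) * ?c"
      using R by (rule mult_right_mono) simp
    finally show ?thesis by simp
  qed
  have "((\<lambda>w. cmod w * ?c / (s - \<rho> * cmod w)) \<longlongrightarrow> cmod 0 * ?c / (s - \<rho> * cmod 0)) (at 0 within ?D)"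
    using s by (intro tendsto_intros) auto
  then have lim: "((\<lambda>w. cmod w * ?c / (s - \<rho> * cmod w)) \<longlongrightarrow> 0) (at 0 within ?D)" by simp
  have "((\<lambda>w. ?K w - ?K 0) \<longlongrightarrow> 0) (at 0 within ?D)"
  proof (rule Lim_null_comparison[OF _ lim])
    show "\<forall>\<^sub>F w in at 0 within ?D. norm (?K w - ?K 0) \<le> cmod w * ?c / (s - \<rho> * cmod w)"
      unfolding eventually_at_filter using bound by (intro always_eventually) blast
  qed
  then show "(?K \<longlongrightarrow> ?K z) (at z within ?D)" unfolding z by (rule LIM_zero_cancel)
qed auto

text \<open>The circle of radius \<open>r\<close> is fixed by its own reflection, so the conjugate of the integrand is there the product
  of \<open>f\<close> and the reflected resolvent, both holomorphic inside: the mean is the value at the centre.\<close>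

lemma conjugate_circle_mean:
  fixes A :: "'a::complex_hilbert \<Rightarrow>\<^sub>L 'a"
  assumes G: "G1_operator A" and x0: "(x0::'a) \<noteq> 0"
    and \<rho>: "0 < \<rho>" "\<rho> < r" "r < 1" "spectrum A \<subseteq> ball 0 \<rho>"
    and f: "f holomorphic_on ball 0 1"
  shows "((\<lambda>t. cnj (f (circlepath 0 r t)) * (circlepath 0 r t * cinner (resolvent A (circlepath 0 r t) x) y))
            has_integral cnj (f 0) * cinner x y) {0..1}"
proof -
  let ?q = "\<lambda>w. of_real (r\<^sup>2) / cnj w"
  let ?K = "\<lambda>w. if w = 0 then cnj (cinner x y) else cnj (?q w * cinner (resolvent A (?q w) x) y)"
  have "?K holomorphic_on ball 0 (r\<^sup>2 / \<rho>)"
    by (rule reflected_resolvent_holomorphic[OF G x0 \<rho>(1,4)]) (use \<rho> in simp)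
  moreover have "r < r\<^sup>2 / \<rho>" using \<rho> by (simp add: field_simps power2_eq_square)
  ultimately have "(\<lambda>w. f w * ?K w) holomorphic_on cball 0 r"
    using \<rho> by (intro holomorphic_on_mult holomorphic_on_subset[OF f]) (auto intro: holomorphic_on_subset)
  then have "((\<lambda>t. f (circlepath 0 r t) * ?K (circlepath 0 r t)) has_integral f 0 * ?K 0) {0..1}"
    by (rule holomorphic_circle_mean) (use \<rho> in simp)
  from has_integral_linear[OF this bounded_linear_cnj]
  have "((\<lambda>t. cnj (f (circlepath 0 r t) * ?K (circlepath 0 r t))) has_integral cnj (f 0 * ?K 0)) {0..1}"
    by (simp only: o_def)
  moreover have "?K (circlepath 0 r t) = cnj (circlepath 0 r t * cinner (resolvent A (circlepath 0 r t) x) y)" for t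
  proof -
    have "cmod (circlepath 0 r t) = r" using \<rho> by (simp add: circlepath norm_mult)
    then have "circlepath 0 r t * cnj (circlepath 0 r t) = of_real (r\<^sup>2)" "circlepath 0 r t \<noteq> 0"
      using \<rho> by (auto simp flip: complex_norm_square)
    then have "?q (circlepath 0 r t) = circlepath 0 r t" by (simp add: field_simps)
    then show ?thesis using \<open>circlepath 0 r t \<noteq> 0\<close> by simp
  qed
  ultimately show ?thesis by simp
qed

text \<open>The operator form of the Schwarz integral formula: \<open>f(A)\<close> is the mean of the Cayley transforms
  \<open>2 z (z - A)\<^sup>-\<^sup>1 - I = (z + A) (z - A)\<^sup>-\<^sup>1\<close> over \<open>\<bar>z\<bar> = r\<close>, with weight \<open>Re f(z)\<close>. With \<open>z (z - A)\<^sup>-\<^sup>1\<close>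
  weighted by \<open>f\<close> the mean is \<open>f(A)\<close>, by the contour integral; weighted by the conjugate of \<open>f\<close> it is \<open>I\<close>;
  so weighted by \<open>2 Re f\<close> it is \<open>f(A) + I\<close>. The term \<open>I\<close> cancels against the mean of \<open>Re f\<close>, which is \<open>1\<close>.\<close>

lemma schwarz_formula:
  fixes A :: "'a::complex_hilbert \<Rightarrow>\<^sub>L 'a"
  assumes G: "G1_operator A" and x0: "(x0::'a) \<noteq> 0"
    and \<sigma>: "spectrum A \<subseteq> ball 0 1" and f: "f holomorphic_on ball 0 1" "f 0 = 1"
  obtains \<rho> where "0 < \<rho>" "\<rho> < 1" "spectrum A \<subseteq> ball 0 \<rho>"
    "\<And>r x y. \<rho> < r \<Longrightarrow> r < 1 \<Longrightarrow>
       ((\<lambda>t. of_real (Re (f (circlepath 0 r t))) *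
              (2 * circlepath 0 r t * cinner (resolvent A (circlepath 0 r t) x) y - cinner x y))
         has_integral cinner (riesz_dunford (ball 0 1) f A x) y) {0..1}"
proof -
  obtain \<rho> where \<rho>: "0 < \<rho>" "\<rho> < 1" "spectrum A \<subseteq> ball 0 \<rho>"
    "\<And>r x y. \<rho> < r \<Longrightarrow> r < 1 \<Longrightarrow> cinner (riesz_dunford (ball 0 1) f A x) y
        = 1 / (2 * of_real pi * \<i>) * contour_integral (circlepath 0 r) (\<lambda>z. f z * cinner (resolvent A z x) y)"
    by (rule riesz_dunford_matrix_element[OF G x0 \<sigma> f(1)]) (rule that)
  have main: "((\<lambda>t. of_real (Re (f (circlepath 0 r t))) *
              (2 * circlepath 0 r t * cinner (resolvent A (circlepath 0 r t) x) y - cinner x y))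
         has_integral cinner (riesz_dunford (ball 0 1) f A x) y) {0..1}"
    if r: "\<rho> < r" "r < 1" for r x y
  proof -
    let ?D = "ball 0 1 - spectrum A"
    let ?c = "circlepath 0 r" and ?B = "riesz_dunford (ball 0 1) f A"
    have r0: "r > 0" using r \<rho> by simp
    have hol: "(\<lambda>z. f z * cinner (resolvent A z x) y) holomorphic_on ?D"
      by (intro holomorphic_on_mult holomorphic_on_subset[OF f(1)]
          holomorphic_on_subset[OF G1_resolvent_weakly_holomorphic[OF G]]) auto
    have "path_image ?c \<subseteq> ?D" using r r0 \<rho>(3) by auto
    then have "(\<lambda>z. f z * cinner (resolvent A z x) y) contour_integrable_on ?c"
      by (intro contour_integrable_holomorphic_simple[OF hol]) (auto simp: G1_spectrum_closed[OF G x0] open_Diff)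
    from has_contour_integral_circle_mean[OF has_contour_integral_integral[OF this]]
    have 1: "((\<lambda>t. f (?c t) * cinner (resolvent A (?c t) x) y * ?c t) has_integral cinner (?B x) y) {0..1}"
      by (simp add: \<rho>(4)[OF r])
    have 2: "((\<lambda>t. cnj (f (?c t)) * (?c t * cinner (resolvent A (?c t) x) y)) has_integral cinner x y) {0..1}"
      using conjugate_circle_mean[OF G x0 \<rho>(1) r \<rho>(3) f(1), of x y] f(2) by simp
    have m: "((\<lambda>t. f (?c t)) has_integral 1) {0..1}"
    proof -
      have "f holomorphic_on cball 0 r"
        by (rule holomorphic_on_subset[OF f(1)]) (use r in auto)
      from holomorphic_circle_mean[OF this r0] show ?thesis by (simp add: f(2))
    qed
    have "((\<lambda>t. cnj (f (?c t))) has_integral cnj 1) {0..1}"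
      using has_integral_linear[OF m bounded_linear_cnj] by (simp only: o_def)
    from has_integral_mult_left[OF has_integral_add[OF m this], of "cinner x y / 2"]
    have "((\<lambda>t. (f (?c t) + cnj (f (?c t))) / 2 * cinner x y) has_integral cinner x y) {0..1}"
      by simp
    from has_integral_diff[OF has_integral_add[OF 1 2] this]
    have "((\<lambda>t. f (?c t) * cinner (resolvent A (?c t) x) y * ?c t + cnj (f (?c t)) * (?c t * cinner (resolvent A (?c t) x) y)
        - (f (?c t) + cnj (f (?c t))) / 2 * cinner x y) has_integral cinner (?B x) y) {0..1}"
      by simp
    then show ?thesis
    proof (rule has_integral_eq[rotated])
      fix t
      let ?R = "cinner (resolvent A (?c t) x) y"
      have h: "of_real (Re (f (?c t))) = (f (?c t) + cnj (f (?c t))) / 2"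
        by (simp add: complex_add_cnj)
      show "f (?c t) * ?R * ?c t + cnj (f (?c t)) * (?c t * ?R) - (f (?c t) + cnj (f (?c t))) / 2 * cinner x y
          = of_real (Re (f (?c t))) * (2 * ?c t * ?R - cinner x y)"
        unfolding h by (simp add: field_simps)
    qed
  qed
  show ?thesis by (rule that[OF \<rho>(1-3)]) (rule main)
qed

section \<open>The numerical radius estimates\<close>

text \<open>Complex linearity of \<open>f(A)\<close> can be read off from the matrix elements. It is what makes \<open>adj\<close>
  meaningful for \<open>f(A)\<close>.\<close>

lemma riesz_dunford_bounded_ops:
  fixes A :: "'a::complex_hilbert \<Rightarrow>\<^sub>L 'a"
  assumes G: "G1_operator A" and x0: "(x0::'a) \<noteq> 0"
    and \<sigma>: "spectrum A \<subseteq> ball 0 1" and f: "f holomorphic_on ball 0 1" "f 0 = 1"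
  shows "riesz_dunford (ball 0 1) f A \<in> bounded_ops"
proof -
  let ?B = "riesz_dunford (ball 0 1) f A"
  obtain \<rho> where \<rho>: "0 < \<rho>" "\<rho> < 1" "spectrum A \<subseteq> ball 0 \<rho>"
    "\<And>r x y. \<rho> < r \<Longrightarrow> r < 1 \<Longrightarrow>
       ((\<lambda>t. of_real (Re (f (circlepath 0 r t))) *
              (2 * circlepath 0 r t * cinner (resolvent A (circlepath 0 r t) x) y - cinner x y))
         has_integral cinner (?B x) y) {0..1}"
    by (rule schwarz_formula[OF G x0 \<sigma> f]) (rule that)
  obtain r where r: "\<rho> < r" "r < 1" using dense \<rho>(2) by blast
  let ?c = "circlepath 0 r"
  have ns: "?c t \<notin> spectrum A" for t
  proof -
    have "cmod (?c t) = r" using r \<rho>(1) by (simp add: circlepath norm_mult)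
    then show ?thesis using \<rho>(3) r by (auto simp: subset_iff)
  qed
  have "?B (c *\<^sub>C x) = c *\<^sub>C ?B x" for c x
  proof (rule cinner_eqI)
    fix y
    have "((\<lambda>t. c * (of_real (Re (f (?c t))) * (2 * ?c t * cinner (resolvent A (?c t) x) y - cinner x y)))
         has_integral c * cinner (?B x) y) {0..1}"
      by (rule has_integral_mult_right[OF \<rho>(4)[OF r]])
    moreover have "c * (of_real (Re (f (?c t))) * (2 * ?c t * cinner (resolvent A (?c t) x) y - cinner x y))
        = of_real (Re (f (?c t))) * (2 * ?c t * cinner (resolvent A (?c t) (c *\<^sub>C x)) y - cinner (c *\<^sub>C x) y)" for t
      by (simp add: bounded_ops_scaleC[OF resolvent_bounded_ops[OF ns]] cinner_scaleC_left algebra_simps)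
    ultimately have "((\<lambda>t. of_real (Re (f (?c t))) * (2 * ?c t * cinner (resolvent A (?c t) (c *\<^sub>C x)) y - cinner (c *\<^sub>C x) y))
         has_integral c * cinner (?B x) y) {0..1}" by simp
    then have "cinner (?B (c *\<^sub>C x)) y = c * cinner (?B x) y"
      using \<rho>(4)[OF r] by (rule has_integral_unique[rotated])
    then show "cinner (?B (c *\<^sub>C x)) y = cinner (c *\<^sub>C ?B x) y" by (simp add: cinner_scaleC_left)
  qed
  then show ?thesis by (simp add: bounded_ops_def)
qed

text \<open>In operator form, with \<open>R = (z - A)\<^sup>-\<^sup>1\<close> and \<open>P = 2 z R - I = (z + A) R\<close>, these are
  \<open>P X + X P\<^sup>* = 2 R (\<bar>z\<bar>\<^sup>2 X - A X A\<^sup>*) R\<^sup>*\<close> and \<open>P X - X P\<^sup>* = 2 R (cnj z A X - z X A\<^sup>*) R\<^sup>*\<close>, evaluated at the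
  vector \<open>x\<close>. Both follow by writing \<open>x = (z - A)\<^sup>* y\<close> with \<open>y = R\<^sup>* x\<close>.\<close>

lemma Cayley_sandwich:
  fixes A X :: "'a::complex_hilbert \<Rightarrow>\<^sub>L 'a" and x :: 'a
  assumes A: "A \<in> bounded_ops" and X: "X \<in> bounded_ops" and z: "z \<notin> spectrum A"
  defines "y \<equiv> adj (resolvent A z) x"
    and "g \<equiv> \<lambda>u. 2 * z * cinner (resolvent A z u) x - cinner u x"
  shows "g (X x) + cnj (g (adj X x))
           = 2 * (of_real ((cmod z)\<^sup>2) * cinner (X y) y - cinner (A (X (adj A y))) y)"
    and "g (X x) - cnj (g (adj X x)) = 2 * (cnj z * cinner (A (X y)) y - z * cinner (X (adj A y)) y)"
proof -
  let ?R = "resolvent A z"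
  note R = resolvent_bounded_ops[OF z]
  have g: "g u = z * cinner u y + cinner (A u) y" for u
  proof -
    have "?R (z *\<^sub>C u - A u) = u" by (rule resolvent_left[OF z])
    then have "z *\<^sub>C ?R u - ?R (A u) = u"
      by (simp add: blinfun.diff_right bounded_ops_scaleC[OF R])
    then have "cinner (z *\<^sub>C ?R u - ?R (A u)) x = cinner u x" by simp
    then have "cinner (?R (A u)) x = z * cinner (?R u) x - cinner u x"
      by (simp add: cinner_simps algebra_simps)
    then show ?thesis
      by (simp add: g_def y_def cinner_adj[OF R, symmetric])
  qed
  have x: "x = cnj z *\<^sub>C y - adj A y"
  proof (rule cinner_eqI)
    fix u
    have "cinner u (cnj z *\<^sub>C y - adj A y) = cinner (z *\<^sub>C u - A u) y"
      by (simp add: cinner_simps cinner_adj[OF A])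
    also have "\<dots> = cinner (?R (z *\<^sub>C u - A u)) x"
      by (simp add: y_def cinner_adj[OF R])
    also have "\<dots> = cinner u x" by (simp only: resolvent_left[OF z])
    finally show "cinner x u = cinner (cnj z *\<^sub>C y - adj A y) u"
      unfolding cinner_commute[of x u] cinner_commute[of "cnj z *\<^sub>C y - adj A y" u] by simp
  qed
  have zz: "of_real ((cmod z)\<^sup>2) = z * cnj z" by (rule complex_norm_square)
  have 1: "g (X x) = z * cnj z * cinner (X y) y - z * cinner (X (adj A y)) y
      + cnj z * cinner (A (X y)) y - cinner (A (X (adj A y))) y"
    unfolding g by (subst (1 2) x)
      (simp add: blinfun.diff_right bounded_ops_scaleC[OF X] bounded_ops_scaleC[OF A] cinner_simps algebra_simps)
  have "cnj (g (adj X x)) = cnj z * cinner y (adj X x) + cinner y (A (adj X x))"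
    unfolding g by (simp add: cinner_commute[of y])
  also have "\<dots> = cnj z * cinner (X y) x + cinner (X (adj A y)) x"
    by (simp add: cinner_adj[OF X] cinner_adj'[OF A])
  also have "\<dots> = z * cnj z * cinner (X y) y - cnj z * cinner (A (X y)) y
      + z * cinner (X (adj A y)) y - cinner (A (X (adj A y))) y"
    by (subst (1 2) x) (simp add: cinner_simps cinner_adj[OF A] algebra_simps)
  finally have 2: "cnj (g (adj X x)) = z * cnj z * cinner (X y) y - cnj z * cinner (A (X y)) y
      + z * cinner (X (adj A y)) y - cinner (A (X (adj A y))) y" .
  show "g (X x) + cnj (g (adj X x))
           = 2 * (of_real ((cmod z)\<^sup>2) * cinner (X y) y - cinner (A (X (adj A y))) y)"
    unfolding 1 2 zz by (simp add: algebra_simps)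
  show "g (X x) - cnj (g (adj X x)) = 2 * (cnj z * cinner (A (X y)) y - z * cinner (X (adj A y)) y)"
    unfolding 1 2 by (simp add: algebra_simps)
qed

lemma weighted_mean_bound:
  fixes h :: "real \<Rightarrow> complex"
  assumes u: "(u has_integral 1) {0..1}" "\<And>t. t \<in> {0..1} \<Longrightarrow> 0 \<le> u t"
    and I: "((\<lambda>t. of_real (u t) * h t) has_integral I) {0..1}"
    and h: "\<And>t. t \<in> {0..1} \<Longrightarrow> cmod (h t) \<le> C"
  shows "cmod I \<le> C"
proof -
  have uC: "((\<lambda>t. u t * C) has_integral 1 * C) {0..1}"
    by (rule has_integral_mult_left[OF u(1)])
  have "norm (integral {0..1} (\<lambda>t. of_real (u t) * h t)) \<le> integral {0..1} (\<lambda>t. u t * C)"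
    by (rule integral_norm_bound_integral)
       (use I uC u(2) h in \<open>auto simp: norm_mult integrable_on_def intro!: mult_left_mono\<close>)
  then show ?thesis
    unfolding integral_unique[OF I] integral_unique[OF uC] by simp
qed

text \<open>The radial projection of \<open>z\<close> to the unit circle moves it by \<open>1 - r\<close>.\<close>

lemma circle_infdist_spectrum:
  assumes d: "dist_circle_spectrum A = d" and ne: "spectrum A \<noteq> {}" and z: "cmod z = r" "0 < r" "r \<le> 1"
  shows "d - (1 - r) \<le> infdist z (spectrum A)"
  unfolding infdist_notempty[OF ne]
proof (rule cINF_greatest[OF ne])
  fix a assume a: "a \<in> spectrum A"
  define v where "v = (1 / r) *\<^sub>R z"
  have "v \<in> sphere 0 1" using z by (simp add: v_def)
  then have "d \<le> dist v a"
    using a d unfolding dist_circle_spectrum_def by (auto intro: setdist_le_dist)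
  also have "\<dots> \<le> dist v z + dist z a" by (rule dist_triangle)
  also have "dist v z = 1 - r"
  proof -
    have "v - z = ((1 - r) / r) *\<^sub>R z" using z by (simp add: v_def diff_divide_distrib algebra_simps)
    then show ?thesis using z by (simp add: dist_norm)
  qed
  finally show "d - (1 - r) \<le> dist z a" by simp
qed

text \<open>Since \<open>f\<close> lives on the open disc only, the mean is taken over the circle of radius \<open>r < 1\<close>. The bounds then
  contain the errors \<open>1 - r\<close> in the distance to the spectrum and \<open>(1 - r\<^sup>2) \<parallel>X\<parallel>\<close> in the sandwiched
  operator, which disappear as \<open>r\<close> tends to \<open>1\<close>.\<close>

lemma numerical_radius_estimates:
  fixes A X :: "'a::complex_hilbert \<Rightarrow>\<^sub>L 'a"
  assumes A: "A \<in> bounded_ops" and G: "G1_operator A" and \<sigma>: "spectrum A \<subseteq> ball 0 1"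
    and f: "f holomorphic_on ball 0 1" "\<And>z. z \<in> ball 0 1 \<Longrightarrow> Re (f z) > 0" "f 0 = 1"
    and X: "X \<in> bounded_ops" and x: "norm (x::'a) = 1"
  defines "B \<equiv> riesz_dunford (ball 0 1) f A" and "d \<equiv> dist_circle_spectrum A"
  shows "cmod (cinner (((B o\<^sub>L X) + (X o\<^sub>L adj B)) x) x) \<le> 2 / d\<^sup>2 * numerical_radius (X - (A o\<^sub>L X o\<^sub>L adj A))"
    and "cmod (cinner (((B o\<^sub>L X) - (X o\<^sub>L adj B)) x) x) \<le> 4 / d\<^sup>2 * norm A * numerical_radius X"
proof -
  have x0: "x \<noteq> 0" using x by auto
  have ne: "spectrum A \<noteq> {}" by (rule G1_spectrum_nonempty[OF G x0])
  have B: "B \<in> bounded_ops" unfolding B_def by (rule riesz_dunford_bounded_ops[OF G x0 \<sigma> f(1,3)])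
  obtain \<rho> where \<rho>: "0 < \<rho>" "\<rho> < 1" "spectrum A \<subseteq> ball 0 \<rho>"
    "\<And>r x y. \<rho> < r \<Longrightarrow> r < 1 \<Longrightarrow>
       ((\<lambda>t. of_real (Re (f (circlepath 0 r t))) *
              (2 * circlepath 0 r t * cinner (resolvent A (circlepath 0 r t) x) y - cinner x y))
         has_integral cinner (riesz_dunford (ball 0 1) f A x) y) {0..1}"
    by (rule schwarz_formula[OF G x0 \<sigma> f(1,3)]) (rule that)
  note schwarz = \<rho>(4)[folded B_def]
  have d: "d > 0"
  proof -
    have "compact (spectrum A)"
      using G1_spectrum_closed[OF G x0] bounded_subset[OF bounded_ball \<sigma>] compact_eq_bounded_closed by blast
    moreover have "sphere 0 1 \<inter> spectrum A = {}" using \<sigma> by auto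
    ultimately have "d \<noteq> 0"
      using ne unfolding d_def dist_circle_spectrum_def
      by (subst setdist_eq_0_compact_closed) (auto intro: compact_imp_closed)
    then show ?thesis using setdist_pos_le[of "sphere 0 1" "spectrum A"]
      unfolding d_def dist_circle_spectrum_def by linarith
  qed
  let ?w = "numerical_radius (X - (A o\<^sub>L X o\<^sub>L adj A))"
  \<comment> \<open>For \<open>r > 1 - d\<close> the estimate \<open>d - (1 - r)\<close> for the distance to the spectrum is positive.\<close>
  define b where "b = max \<rho> (1 - d)"
  have b: "b < 1" "\<rho> \<le> b" "1 - d \<le> b" using \<rho> d by (auto simp: b_def)
  have est: "cmod (cinner (((B o\<^sub>L X) + (X o\<^sub>L adj B)) x) x) \<le> 2 * (?w + (1 - r\<^sup>2) * norm X) / (d - (1 - r))\<^sup>2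
     \<and> cmod (cinner (((B o\<^sub>L X) - (X o\<^sub>L adj B)) x) x) \<le> 4 * norm A * numerical_radius X / (d - (1 - r))\<^sup>2"
    if r: "b < r" "r < 1" for r
  proof -
    let ?c = "circlepath 0 r"
    have \<rho>r: "\<rho> < r" using r b by simp
    have r0: "0 < r" using \<rho>r \<rho> by simp
    have cr: "cmod (?c t) = r" for t using r0 by (simp add: circlepath norm_mult)
    have ns: "?c t \<notin> spectrum A" for t
      using \<rho>(3) \<rho>r cr[of t] by (auto simp: subset_iff)
    define u where "u = (\<lambda>t. Re (f (?c t)))"
    define g where "g = (\<lambda>t v. 2 * ?c t * cinner (resolvent A (?c t) v) x - cinner v x)"
    define y where "y = (\<lambda>t. adj (resolvent A (?c t)) x)"
    have sch: "((\<lambda>t. of_real (u t) * g t v) has_integral cinner (B v) x) {0..1}" for v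
      using schwarz[OF \<rho>r r(2), of v x] by (simp add: u_def g_def)
    have u0: "0 \<le> u t" for t
      using f(2)[of "?c t"] cr[of t] r by (simp add: u_def less_imp_le)
    have "f holomorphic_on cball 0 r"
      by (rule holomorphic_on_subset[OF f(1)]) (use r in auto)
    from has_integral_linear[OF holomorphic_circle_mean[OF this r0] bounded_linear_Re]
    have u1: "(u has_integral 1) {0..1}" by (simp add: u_def o_def f(3))
    have "(cnj \<circ> (\<lambda>t. of_real (u t) * g t (adj X x)) has_integral cnj (cinner (B (adj X x)) x)) {0..1}"
      by (rule has_integral_linear[OF sch bounded_linear_cnj])
    moreover have "cnj (cinner (B (adj X x)) x) = cinner (X (adj B x)) x"
      by (simp add: cinner_adj[OF B] cinner_adj[OF X] flip: cinner_commute)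
    ultimately have sch': "((\<lambda>t. of_real (u t) * cnj (g t (adj X x))) has_integral cinner (X (adj B x)) x) {0..1}"
      by (simp add: o_def)
    have plus: "((\<lambda>t. of_real (u t) * (g t (X x) + cnj (g t (adj X x))))
        has_integral cinner (((B o\<^sub>L X) + (X o\<^sub>L adj B)) x) x) {0..1}"
      using has_integral_add[OF sch[of "X x"] sch'] by (simp add: blinfun.add_left cinner_add_left distrib_left)
    have minus: "((\<lambda>t. of_real (u t) * (g t (X x) - cnj (g t (adj X x))))
        has_integral cinner (((B o\<^sub>L X) - (X o\<^sub>L adj B)) x) x) {0..1}"
      using has_integral_diff[OF sch[of "X x"] sch'] by (simp add: blinfun.diff_left cinner_diff_left right_diff_distrib)
    define \<delta> where "\<delta> = d - (1 - r)"
    have \<delta>: "\<delta> > 0" using r b by (simp add: \<delta>_def)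
    have y: "(norm (y t))\<^sup>2 \<le> 1 / \<delta>\<^sup>2" for t
    proof -
      have "\<delta> \<le> infdist (?c t) (spectrum A)"
        unfolding \<delta>_def using r r0 by (intro circle_infdist_spectrum ne cr) (auto simp: d_def)
      then have "norm (resolvent A (?c t)) \<le> 1 / \<delta>"
        unfolding G1_norm_resolvent[OF G ns] using \<delta> by (intro divide_left_mono) auto
      moreover have "norm (y t) \<le> norm (resolvent A (?c t))"
        using norm_adj_apply_le[OF resolvent_bounded_ops[OF ns], of t x] x by (simp add: y_def)
      ultimately have "norm (y t) \<le> 1 / \<delta>" by linarith
      then have "(norm (y t))\<^sup>2 \<le> (1 / \<delta>)\<^sup>2" by (intro power_mono) auto
      then show ?thesis by (simp add: power_divide)
    qed
    have scale: "C * (norm (y t))\<^sup>2 \<le> C / \<delta>\<^sup>2" if "0 \<le> C" for C t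
      using mult_left_mono[OF y that, of t] by simp
    have 1: "cmod (g t (X x) + cnj (g t (adj X x))) \<le> 2 * (?w + (1 - r\<^sup>2) * norm X) / \<delta>\<^sup>2" for t
    proof -
      have r2: "0 \<le> 1 - r\<^sup>2" using r r0 by (simp add: power_le_one)
      have "g t (X x) + cnj (g t (adj X x))
          = 2 * (of_real (r\<^sup>2) * cinner (X (y t)) (y t) - cinner (A (X (adj A (y t)))) (y t))"
        using Cayley_sandwich(1)[OF A X ns[of t], of x] unfolding g_def y_def cr .
      also have "\<dots> = 2 * (cinner ((X - (A o\<^sub>L X o\<^sub>L adj A)) (y t)) (y t) - of_real (1 - r\<^sup>2) * cinner (X (y t)) (y t))"
        by (simp add: blinfun.diff_left cinner_diff_left algebra_simps)
      finally have "cmod (g t (X x) + cnj (g t (adj X x)))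
          = 2 * cmod (cinner ((X - (A o\<^sub>L X o\<^sub>L adj A)) (y t)) (y t) - of_real (1 - r\<^sup>2) * cinner (X (y t)) (y t))"
        by (simp only: norm_mult) simp
      also have "\<dots> \<le> 2 * (cmod (cinner ((X - (A o\<^sub>L X o\<^sub>L adj A)) (y t)) (y t))
          + (1 - r\<^sup>2) * cmod (cinner (X (y t)) (y t)))"
        using norm_triangle_ineq4[of "cinner ((X - (A o\<^sub>L X o\<^sub>L adj A)) (y t)) (y t)" "of_real (1 - r\<^sup>2) * cinner (X (y t)) (y t)"] r2
        by (simp only: norm_mult norm_of_real abs_of_nonneg) simp
      also have "\<dots> \<le> 2 * (?w * (norm (y t))\<^sup>2 + (1 - r\<^sup>2) * (norm X * (norm (y t))\<^sup>2))"
      proof -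
        have "cmod (cinner (X (y t)) (y t)) \<le> norm (X (y t)) * norm (y t)" by (rule cinner_Cauchy_Schwarz)
        also have "\<dots> \<le> norm X * norm (y t) * norm (y t)" by (intro mult_right_mono norm_blinfun) auto
        finally have "cmod (cinner (X (y t)) (y t)) \<le> norm X * (norm (y t))\<^sup>2"
          by (simp add: power2_eq_square mult.assoc)
        then show ?thesis
          by (intro mult_left_mono add_mono cinner_le_numerical_radius r2) auto
      qed
      also have "\<dots> = (2 * (?w + (1 - r\<^sup>2) * norm X)) * (norm (y t))\<^sup>2" by (simp add: algebra_simps)
      also have "\<dots> \<le> (2 * (?w + (1 - r\<^sup>2) * norm X)) / \<delta>\<^sup>2"
        using r2 by (intro scale mult_nonneg_nonneg add_nonneg_nonneg numerical_radius_nonneg) auto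
      finally show ?thesis .
    qed
    have 2: "cmod (g t (X x) - cnj (g t (adj X x))) \<le> 4 * norm A * numerical_radius X / \<delta>\<^sup>2" for t
    proof -
      have "g t (X x) - cnj (g t (adj X x))
          = 2 * (cnj (?c t) * cinner (A (X (y t))) (y t) - ?c t * cinner (X (adj A (y t))) (y t))"
        using Cayley_sandwich(2)[OF A X ns[of t], of x] unfolding g_def y_def .
      then have "cmod (g t (X x) - cnj (g t (adj X x)))
          = 2 * cmod (cnj (?c t) * cinner (A (X (y t))) (y t) - cnj (cnj (?c t)) * cinner (X (adj A (y t))) (y t))"
        by (simp only: norm_mult) simp
      also have "\<dots> \<le> 2 * (2 * (r * norm A) * numerical_radius X * (norm (y t))\<^sup>2)"
        using twisted_commutator_le[OF A X, of "cnj (?c t)" "y t"] by (simp only: complex_mod_cnj cr)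
      also have "\<dots> = r * ((4 * norm A * numerical_radius X) * (norm (y t))\<^sup>2)" by simp
      also have "\<dots> \<le> 1 * ((4 * norm A * numerical_radius X) * (norm (y t))\<^sup>2)"
        using r by (intro mult_right_mono mult_nonneg_nonneg numerical_radius_nonneg) auto
      also have "\<dots> \<le> (4 * norm A * numerical_radius X) / \<delta>\<^sup>2"
        unfolding mult_1 by (intro scale mult_nonneg_nonneg numerical_radius_nonneg) auto
      finally show ?thesis .
    qed
    show ?thesis
      using weighted_mean_bound[OF u1 u0 plus 1] weighted_mean_bound[OF u1 u0 minus 2] unfolding \<delta>_def by blast
  qed
  have ev: "eventually (\<lambda>r. b < r \<and> r < 1) (at_left 1)"
    using b(1) by (auto simp: eventually_at_left)
  have "((\<lambda>r. 2 * (?w + (1 - r\<^sup>2) * norm X) / (d - (1 - r))\<^sup>2)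
      \<longlongrightarrow> 2 * (?w + (1 - 1\<^sup>2) * norm X) / (d - (1 - 1))\<^sup>2) (at_left 1)"
    using d by (intro tendsto_intros) auto
  from tendsto_lowerbound[OF this eventually_mono[OF ev]] est
  have "cmod (cinner (((B o\<^sub>L X) + (X o\<^sub>L adj B)) x) x) \<le> 2 * (?w + (1 - 1\<^sup>2) * norm X) / (d - (1 - 1))\<^sup>2"
    by simp
  then show "cmod (cinner (((B o\<^sub>L X) + (X o\<^sub>L adj B)) x) x) \<le> 2 / d\<^sup>2 * ?w" by simp
  have "((\<lambda>r. 4 * norm A * numerical_radius X / (d - (1 - r))\<^sup>2)
      \<longlongrightarrow> 4 * norm A * numerical_radius X / (d - (1 - 1))\<^sup>2) (at_left 1)"
    using d by (intro tendsto_intros) auto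
  from tendsto_lowerbound[OF this eventually_mono[OF ev]] est
  have "cmod (cinner (((B o\<^sub>L X) - (X o\<^sub>L adj B)) x) x) \<le> 4 * norm A * numerical_radius X / (d - (1 - 1))\<^sup>2"
    by simp
  then show "cmod (cinner (((B o\<^sub>L X) - (X o\<^sub>L adj B)) x) x) \<le> 4 / d\<^sup>2 * norm A * numerical_radius X" by simp
qed

theorem theorem2p2:
  fixes A X :: "'a::complex_hilbert \<Rightarrow>\<^sub>L 'a" and f :: "complex \<Rightarrow> complex"
  assumes "A \<in> bounded_ops" and "G1_operator A" and "spectrum A \<subseteq> ball 0 1"
    and "f \<in> frakA"
    and "X \<in> bounded_ops"
  shows "numerical_radius ((riesz_dunford (ball 0 1) f A o\<^sub>L X) + (X o\<^sub>L adj (riesz_dunford (ball 0 1) f A)))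
           \<le> 2 / (dist_circle_spectrum A)\<^sup>2 * numerical_radius (X - (A o\<^sub>L X o\<^sub>L adj A))
       \<and> numerical_radius ((riesz_dunford (ball 0 1) f A o\<^sub>L X) - (X o\<^sub>L adj (riesz_dunford (ball 0 1) f A)))
           \<le> 4 / (dist_circle_spectrum A)\<^sup>2 * norm A * numerical_radius X"
proof -
  have f: "f holomorphic_on ball 0 1" "\<And>z. z \<in> ball 0 1 \<Longrightarrow> Re (f z) > 0" "f 0 = 1"
    using assms(4) by (auto simp: frakA_def intro: analytic_imp_holomorphic)
  show ?thesis
  proof (intro conjI; rule numerical_radius_le)
    note est = numerical_radius_estimates[OF assms(1-3) f assms(5)]
    show "cmod (cinner (((riesz_dunford (ball 0 1) f A o\<^sub>L X) + (X o\<^sub>L adj (riesz_dunford (ball 0 1) f A))) x) x)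
        \<le> 2 / (dist_circle_spectrum A)\<^sup>2 * numerical_radius (X - (A o\<^sub>L X o\<^sub>L adj A))"
      if "norm x = 1" for x
      by (rule est(1)[OF _ that])
    show "cmod (cinner (((riesz_dunford (ball 0 1) f A o\<^sub>L X) - (X o\<^sub>L adj (riesz_dunford (ball 0 1) f A))) x) x)
        \<le> 4 / (dist_circle_spectrum A)\<^sup>2 * norm A * numerical_radius X"
      if "norm x = 1" for x
      by (rule est(2)[OF _ that])
  qed (simp_all add: numerical_radius_nonneg)
qed

end
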